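(* Let $n\ge3$ and let $m_1<\cdots<m_n$ be positive integers with $m_i=h\,m_1+(i-1)d$ for all $i\in\{2,\ldots,n\}$, where $h,d\in\mathbb{Z}^+$, $\gcd\{m_1,d\}=1$, $h>1$ and $h$ divides $d$. Then $\mathrm{reg}(K[\mathcal{C}])$ is attained at the last step of a minimal graded free resolution of $K[\mathcal{C}]$; that is, if $0\to\bigoplus_{j=1}^{\beta_p}R(-e_{pj})\to\cdots\to\bigoplus_{j=1}^{\beta_1}R(-e_{1j})\to R\to K[\mathcal{C}]\to0$ is a minimal graded free resolution over $R$ (with $\beta_p\neq0$), then $\mathrm{reg}(K[\mathcal{C}])=\max\{e_{pj}-p:1\le j\le\beta_p\}$.
   Context: $K$ is an infinite field and $R=K[x_1,\ldots,x_{n+1}]$ with its standard grading. For positive integers $m_1<\cdots<m_n$, the associated projective monomial curve $\mathcal{C}\subset\mathbb{P}^n_K$ is parametrically defined by $x_i=u^{m_i}v^{m_n-m_i}$ for $1\le i\le n$ and $x_{n+1}=v^{m_n}$. Its vanishing ideal $I(\mathcal{C})\subset R$ is the kernel of the $K$-algebra homomorphism $R\to K[u,v]$, $x_i\mapsto u^{m_i}v^{m_n-m_i}$ ($1\le i\le n$), $x_{n+1}\mapsto v^{m_n}$, and $K[\mathcal{C}]=R/I(\mathcal{C})$. The Castelnuovo-Mumford regularity is $\mathrm{reg}(K[\mathcal{C}])=\max\{e_{ij}-i:1\le i\le p,\ 1\le j\le\beta_i\}$ in terms of the shifts of the minimal graded free resolution. *)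

theory Defs
  imports Complex_Main "HOL-Library.Poly_Mapping"
begin

text \<open>
  Polynomials over \<^typ>\<open>'k\<close> in indeterminates indexed by natural numbers: a monomial is a finitely
  supported exponent vector, a polynomial a finitely supported family of coefficients.
\<close>

type_synonym 'k mpoly = "(nat \<Rightarrow>\<^sub>0 nat) \<Rightarrow>\<^sub>0 'k"

definition Var :: "nat \<Rightarrow> 'k::comm_ring_1 mpoly" where
  "Var i = Poly_Mapping.single (Poly_Mapping.single i 1) 1"

definition Const :: "'k::comm_ring_1 \<Rightarrow> 'k mpoly" where
  "Const c = Poly_Mapping.single 0 c"

definition poly_ring :: "nat \<Rightarrow> 'k::comm_ring_1 mpoly set" where
  "poly_ring N = {f. \<forall>t \<in> Poly_Mapping.keys f. Poly_Mapping.keys t \<subseteq> {1..N}}"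

definition mon_deg :: "(nat \<Rightarrow>\<^sub>0 nat) \<Rightarrow> nat" where
  "mon_deg t = (\<Sum>i \<in> Poly_Mapping.keys t. Poly_Mapping.lookup t i)"

text \<open>
  Degrees are integers, so that shifts may be arbitrary; in particular a homogeneous
  polynomial of negative degree is zero.
\<close>

definition homog_poly :: "int \<Rightarrow> 'k::comm_ring_1 mpoly \<Rightarrow> bool" where
  "homog_poly d f \<longleftrightarrow> (\<forall>t \<in> Poly_Mapping.keys f. int (mon_deg t) = d)"

definition subst_hom :: "(nat \<Rightarrow> 'k mpoly) \<Rightarrow> 'k::comm_ring_1 mpoly \<Rightarrow> 'k mpoly" where
  "subst_hom g f = (\<Sum>t \<in> Poly_Mapping.keys f.
     Const (Poly_Mapping.lookup f t) *
       (\<Prod>i \<in> Poly_Mapping.keys t. g i ^ Poly_Mapping.lookup t i))"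

text \<open>
  In the target ring \<open>K[u,v]\<close> the indeterminates \<open>u\<close> and \<open>v\<close> are \<open>Var 1\<close> and \<open>Var 2\<close>.
  The subtraction of exponents is on natural numbers; it is meant for \<open>m i \<le> m n\<close>.
\<close>

definition curve_param :: "nat \<Rightarrow> (nat \<Rightarrow> nat) \<Rightarrow> nat \<Rightarrow> 'k::comm_ring_1 mpoly" where
  "curve_param n m i =
     (if i \<le> n then Var 1 ^ m i * Var 2 ^ (m n - m i) else Var 2 ^ m n)"

definition vanishing_ideal :: "nat \<Rightarrow> (nat \<Rightarrow> nat) \<Rightarrow> 'k::comm_ring_1 mpoly set" where
  "vanishing_ideal n m = {f \<in> poly_ring (n + 1). subst_hom (curve_param n m) f = 0}"

text \<open>
  With \<open>R = poly_ring N\<close>, the underlying module of \<open>R(-e 1) \<oplus> \<dots> \<oplus> R(-e b)\<close> is the set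
  of vectors of polynomials with coordinates \<open>1, \<dots>, b\<close>, extended by zero. Since
  \<open>R(-a)\<close> has \<open>R\<close> in degree \<open>d - a\<close> as its component of degree \<open>d\<close>, a vector is homogeneous
  of degree \<open>d\<close> if its \<open>j\<close>-th coordinate is homogeneous of degree \<open>d - e j\<close>.
\<close>

definition free_mod :: "nat \<Rightarrow> nat \<Rightarrow> (nat \<Rightarrow> 'k::comm_ring_1 mpoly) set" where
  "free_mod N b = {x. (\<forall>j. x j \<in> poly_ring N) \<and> (\<forall>j. j \<notin> {1..b} \<longrightarrow> x j = 0)}"

definition homog_vec :: "(nat \<Rightarrow> int) \<Rightarrow> int \<Rightarrow> (nat \<Rightarrow> 'k::comm_ring_1 mpoly) \<Rightarrow> bool" where
  "homog_vec e d x \<longleftrightarrow> (\<forall>j. homog_poly (d - e j) (x j))"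

definition graded_hom ::
  "nat \<Rightarrow> nat \<Rightarrow> (nat \<Rightarrow> int) \<Rightarrow> nat \<Rightarrow> (nat \<Rightarrow> int) \<Rightarrow>
   ((nat \<Rightarrow> 'k::comm_ring_1 mpoly) \<Rightarrow> (nat \<Rightarrow> 'k mpoly)) \<Rightarrow> bool" where
  "graded_hom N b e b' e' \<phi> \<longleftrightarrow>
     (\<forall>x \<in> free_mod N b. \<phi> x \<in> free_mod N b') \<and>
     (\<forall>x \<in> free_mod N b. \<forall>y \<in> free_mod N b. \<phi> (\<lambda>j. x j + y j) = (\<lambda>k. \<phi> x k + \<phi> y k)) \<and>
     (\<forall>a \<in> poly_ring N. \<forall>x \<in> free_mod N b. \<phi> (\<lambda>j. a * x j) = (\<lambda>k. a * \<phi> x k)) \<and>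
     (\<forall>d. \<forall>x \<in> free_mod N b. homog_vec e d x \<longrightarrow> homog_vec e' d (\<phi> x))"

definition hom_ker ::
  "nat \<Rightarrow> nat \<Rightarrow> ((nat \<Rightarrow> 'k::comm_ring_1 mpoly) \<Rightarrow> (nat \<Rightarrow> 'k mpoly)) \<Rightarrow> (nat \<Rightarrow> 'k mpoly) set" where
  "hom_ker N b \<phi> = {x \<in> free_mod N b. \<phi> x = (\<lambda>k. 0)}"

text \<open>
  \<open>is_min_graded_free_res N I p \<beta> e \<phi>\<close>: with \<open>R = poly_ring N\<close>, a homogeneous ideal \<open>I\<close> of
  \<open>R\<close> and \<open>F i = R(-e i 1) \<oplus> \<dots> \<oplus> R(-e i (\<beta> i))\<close>, the sequence
  \<open>0 \<rightarrow> F p \<rightarrow> \<dots> \<rightarrow> F 1 \<rightarrow> F 0 = R \<rightarrow> R/I \<rightarrow> 0\<close> with the maps \<open>\<phi> i : F i \<rightarrow> F (i - 1)\<close> and the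
  canonical projection \<open>R \<rightarrow> R/I\<close> is a minimal graded free resolution. The projection is
  surjective with kernel \<open>I\<close>, so exactness at \<open>R\<close> says that the image of \<open>\<phi> 1\<close> is \<open>I\<close>.
  The last two conditions are minimality, i.e. \<open>\<phi> i (F i) \<subseteq> \<mm> F (i - 1)\<close> where \<open>\<mm>\<close> is the ideal
  generated by the indeterminates (the polynomials without constant term), and \<open>F p \<noteq> 0\<close>.
\<close>

definition is_min_graded_free_res ::
  "nat \<Rightarrow> 'k::comm_ring_1 mpoly set \<Rightarrow> nat \<Rightarrow> (nat \<Rightarrow> nat) \<Rightarrow> (nat \<Rightarrow> nat \<Rightarrow> int) \<Rightarrow>
   (nat \<Rightarrow> (nat \<Rightarrow> 'k mpoly) \<Rightarrow> (nat \<Rightarrow> 'k mpoly)) \<Rightarrow> bool" where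
  "is_min_graded_free_res N I p \<beta> e \<phi> \<longleftrightarrow>
     1 \<le> p \<and> \<beta> 0 = 1 \<and> e 0 1 = 0 \<and>
     (\<forall>i \<in> {1..p}. graded_hom N (\<beta> i) (e i) (\<beta> (i - 1)) (e (i - 1)) (\<phi> i)) \<and>
     (\<lambda>x. x 1) ` \<phi> 1 ` free_mod N (\<beta> 1) = I \<and>
     (\<forall>i \<in> {1..<p}. hom_ker N (\<beta> i) (\<phi> i) = \<phi> (i + 1) ` free_mod N (\<beta> (i + 1))) \<and>
     hom_ker N (\<beta> p) (\<phi> p) = {\<lambda>j. 0} \<and>
     (\<forall>i \<in> {1..p}. \<forall>x \<in> free_mod N (\<beta> i). \<forall>k. Poly_Mapping.lookup (\<phi> i x k) 0 = 0) \<and>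
     \<beta> p \<noteq> 0"

text \<open>
  The Castelnuovo-Mumford regularity of \<open>R/I\<close> for \<open>R = poly_ring N\<close> and a homogeneous ideal
  \<open>0 \<noteq> I \<noteq> R\<close>. The description is definite because the shifts of a minimal graded free
  resolution are unique up to permutation within each homological degree.
\<close>

definition reg_quot :: "nat \<Rightarrow> 'k::field mpoly set \<Rightarrow> int" where
  "reg_quot N I = (THE r. \<exists>p \<beta> e \<phi>. is_min_graded_free_res N I p \<beta> e \<phi> \<and>
     r = Max {e i j - int i | i j. i \<in> {1..p} \<and> j \<in> {1..\<beta> i}})"

end

(*
  The shifts of a minimal graded free resolution of K[C] are read off Koszul homology: shifting
  dimensions along the resolution, the degree D occurs as a shift in step i iff the i-th Koszul
  homology of K[C] is nonzero in degree D. K[C] is the semigroup ring of the semigroup S of all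
  (delta, x) such that x is a sum of delta elements of {m_1, ..., m_n, 0}, so in each multidegree
  this homology is that of the simplicial complex of the sets of generators that can be
  subtracted within S.

  For m_1 = a and d = h d', every x has a canonical form rho a + h (q a + d' sigma) with rho < h
  in which the least delta is max (rho + q) (rho + h q - (h - 1) sigma). Let r be the largest
  least delta among the elements with q > sigma, which are those whose degree grows by less than
  k when k m_n is added for some k. Above degree r all of the simplicial complexes are acyclic,
  by means of two cones whose apexes are the variables x_n and x_(n+1). An element attaining r
  yields a complex that is the full boundary of the simplex on all n + 1 variables. Hence the
  resolution has length n, every shift e_ij satisfies e_ij - i <= r, and equality holds for some
  shift in step n.
*)
theory Submission
  imports Defs "HOL-Library.Function_Algebras"
begin

section \<open>Koszul homology\<close>

text \<open>The value of r comes from local cohomology. A monomial outside K[C] that powers of x_n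
  and powers of x_(n+1) both carry into K[C] represents a class of H^1_m. The largest degree of such
  a class is r - 1, so H^1_m contributes r to the regularity, and as K[C] has depth 1 this
  contribution shows at the last step. What must be excluded is a larger contribution of H^2_m. An
  element of least degree above r from which x_n cannot be removed would have q \<le> sigma, least
  degree rho + q and sigma < q + N - 1, where N = n - 1. Then (q - 1, q - 2) is one of the pairs
  that define r, with least degree rho + q + h - 2; as h \<ge> 2 this is at least rho + q, a
  contradiction. The regularity is a definite description over all minimal resolutions, so the
  shifts have to be found for an arbitrary one. Koszul homology is attached to K[C] alone, and it
  enters only as exactness in a single degree, so no homology groups or Tor are formed.\<close>

definition ksgn :: "nat \<Rightarrow> nat set \<Rightarrow> 'g::ab_group_add \<Rightarrow> 'g" where
  "ksgn k B g = (if even (card {b \<in> B. b < k}) then g else - g)"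

text \<open>The Koszul differential in coordinates: \<open>c A\<close> is the coefficient of the
  exterior basis element indexed by \<open>A\<close>. Signs use negation only, so that the
  coefficients may come from any abelian group: a free module, the semigroup ring, or the field
  itself in a fixed multidegree.\<close>

definition kbd :: "nat set \<Rightarrow> (nat \<Rightarrow> 'g \<Rightarrow> 'g) \<Rightarrow> (nat set \<Rightarrow> 'g) \<Rightarrow> nat set \<Rightarrow> 'g::ab_group_add" where
  "kbd V X c B = (if B \<subseteq> V then \<Sum>k \<in> V - B. ksgn k B (X k (c (insert k B))) else 0)"

definition kchains :: "nat set \<Rightarrow> 'g set \<Rightarrow> nat \<Rightarrow> (nat set \<Rightarrow> 'g::ab_group_add) set" where
  "kchains V H q = {c. \<forall>A. (A \<subseteq> V \<and> card A = q \<longrightarrow> c A \<in> H) \<and> (\<not> (A \<subseteq> V \<and> card A = q) \<longrightarrow> c A = 0)}"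

text \<open>
  Vanishing of the \<open>q\<close>-th Koszul homology in total degree \<open>D\<close>, for a graded module whose
  components \<open>G d\<close> lie in one ambient group on which the variables act by \<open>X\<close>.
\<close>

definition kexact ::
  "nat set \<Rightarrow> (nat \<Rightarrow> 'g \<Rightarrow> 'g) \<Rightarrow> (int \<Rightarrow> 'g::ab_group_add set) \<Rightarrow> nat \<Rightarrow> int \<Rightarrow> bool" where
  "kexact V X G q D \<longleftrightarrow> (\<forall>c \<in> kchains V (G (D - int q)) q. kbd V X c = (\<lambda>_. 0) \<longrightarrow>
     (\<exists>b \<in> kchains V (G (D - int q - 1)) (Suc q). kbd V X b = c))"

lemma ksgn_add: "ksgn k B (x + y) = ksgn k B x + ksgn k B y"
  by (simp add: ksgn_def)

lemma ksgn_diff: "ksgn k B (x - y) = ksgn k B x - ksgn k B y"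
  by (simp add: ksgn_def)

lemma ksgn_0 [simp]: "ksgn k B 0 = 0"
  by (simp add: ksgn_def)

lemma ksgn_eq_0_iff [simp]: "ksgn k B x = 0 \<longleftrightarrow> x = 0"
  by (simp add: ksgn_def)

lemma ksgn_ksgn [simp]: "ksgn k B (ksgn k B x) = x"
  by (simp add: ksgn_def)

lemma ksgn_sum: "ksgn k B (sum f I) = (\<Sum>i\<in>I. ksgn k B (f i))"
  by (simp add: ksgn_def sum_negf)

lemma ksgn_insert:
  assumes "finite B" "l \<notin> B" "k \<notin> B" "k \<noteq> l"
  shows "ksgn k (insert l B) x = (if l < k then - ksgn k B x else ksgn k B x)"
proof -
  have "{b \<in> insert l B. b < k} = (if l < k then insert l {b \<in> B. b < k} else {b \<in> B. b < k})"
    by auto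
  then show ?thesis using assms by (simp add: ksgn_def)
qed

text \<open>The terms for \<open>(k, l)\<close> and \<open>(l, k)\<close> are cancelled in pairs.
  Deriving that the sum equals its own negative would not be enough in characteristic 2.\<close>

lemma sum_antisym_eq_0:
  fixes f :: "nat \<Rightarrow> nat \<Rightarrow> 'g::ab_group_add"
  assumes "finite W" "\<And>k l. k \<in> W \<Longrightarrow> l \<in> W \<Longrightarrow> k \<noteq> l \<Longrightarrow> f k l = - f l k"
  shows "(\<Sum>k\<in>W. \<Sum>l\<in>W - {k}. f k l) = 0"
proof -
  let ?U = "{(k, l). k \<in> W \<and> l \<in> W \<and> k < l}"
  let ?L = "{(k, l). k \<in> W \<and> l \<in> W \<and> l < k}"
  have fin: "finite ?U" "finite ?L"
    using assms(1) by (auto intro: finite_subset[of _ "W \<times> W"])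
  have "(\<Sum>k\<in>W. \<Sum>l\<in>W - {k}. f k l) = (\<Sum>(k, l) \<in> (SIGMA k:W. W - {k}). f k l)"
    using assms(1) by (subst sum.Sigma) auto
  also have "(SIGMA k:W. W - {k}) = ?U \<union> ?L" by auto
  also have "(\<Sum>(k, l) \<in> ?U \<union> ?L. f k l) = (\<Sum>(k, l) \<in> ?U. f k l) + (\<Sum>(k, l) \<in> ?L. f k l)"
    using fin by (intro sum.union_disjoint) auto
  also have "(\<Sum>(k, l) \<in> ?L. f k l) = (\<Sum>(k, l) \<in> ?U. - f k l)"
    by (rule sum.reindex_bij_witness[of _ "\<lambda>(k, l). (l, k)" "\<lambda>(k, l). (l, k)"])
      (auto intro: assms(2)[symmetric])
  also have "\<dots> = - (\<Sum>(k, l) \<in> ?U. f k l)"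
    by (simp add: sum_negf case_prod_unfold)
  finally show ?thesis by simp
qed

locale koszul =
  fixes V :: "nat set" and X :: "nat \<Rightarrow> 'g::ab_group_add \<Rightarrow> 'g"
  assumes finite_V: "finite V"
    and X_add: "X k (x + y) = X k x + X k y"
    and X_comm: "X k (X l x) = X l (X k x)"
begin

lemma X_0 [simp]: "X k 0 = 0"
  using X_add[of k 0 0] by simp

lemma X_uminus: "X k (- x) = - X k x"
  using X_add[of k x "- x"] by (simp add: eq_neg_iff_add_eq_0 add.commute)

lemma X_diff: "X k (x - y) = X k x - X k y"
  using X_add[of k x "- y"] by (simp add: X_uminus)

lemma X_sum: "X k (sum f I) = (\<Sum>i\<in>I. X k (f i))"
  by (induction I rule: infinite_finite_induct) (auto simp: X_add)

lemma X_ksgn: "X k (ksgn l B x) = ksgn l B (X k x)"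
  by (simp add: ksgn_def X_uminus)

lemma kbd_add: "kbd V X (\<lambda>A. c A + c' A) = (\<lambda>A. kbd V X c A + kbd V X c' A)"
  by (auto simp: kbd_def fun_eq_iff X_add ksgn_add sum.distrib)

lemma kbd_diff: "kbd V X (\<lambda>A. c A - c' A) = (\<lambda>A. kbd V X c A - kbd V X c' A)"
  by (auto simp: kbd_def fun_eq_iff X_diff ksgn_diff sum_subtractf)

lemma kbd_kbd: "kbd V X (kbd V X c) = (\<lambda>_. 0)"
proof
  fix B
  show "kbd V X (kbd V X c) B = 0"
  proof (cases "B \<subseteq> V")
    case True
    then have finB: "finite B" using finite_V finite_subset by blast
    define f where "f k l = ksgn k B (ksgn l (insert k B) (X k (X l (c (insert l (insert k B))))))" for k l
    have "kbd V X (kbd V X c) B = (\<Sum>k\<in>V - B. \<Sum>l\<in>V - B - {k}. f k l)"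
      unfolding kbd_def[of V X "kbd V X c"] if_P[OF True]
    proof (rule sum.cong)
      fix k assume k: "k \<in> V - B"
      have V_eq: "V - insert k B = V - B - {k}" by blast
      show "ksgn k B (X k (kbd V X c (insert k B))) = (\<Sum>l\<in>V - B - {k}. f k l)"
        using k True by (simp add: kbd_def f_def X_sum ksgn_sum X_ksgn V_eq)
    qed simp
    also have "\<dots> = 0"
    proof (rule sum_antisym_eq_0)
      show "finite (V - B)" using finite_V by simp
    next
      fix k l assume kl: "k \<in> V - B" "l \<in> V - B" "k \<noteq> l"
      have "X k (X l (c (insert l (insert k B)))) = X l (X k (c (insert k (insert l B))))"
        by (simp add: X_comm[of k l] insert_commute)
      then show "f k l = - f l k"
        using kl finB by (simp add: f_def ksgn_insert) (auto simp: ksgn_def)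
    qed
    finally show ?thesis .
  qed (simp add: kbd_def)
qed

end

lemma kchainsI:
  assumes "\<And>A. A \<subseteq> V \<Longrightarrow> card A = q \<Longrightarrow> c A \<in> H"
    and "\<And>A. \<not> (A \<subseteq> V \<and> card A = q) \<Longrightarrow> c A = 0"
  shows "c \<in> kchains V H q"
  using assms by (auto simp: kchains_def)

lemma kchains_mem: "c \<in> kchains V H q \<Longrightarrow> A \<subseteq> V \<Longrightarrow> card A = q \<Longrightarrow> c A \<in> H"
  by (auto simp: kchains_def)

lemma kchains_0: "c \<in> kchains V H q \<Longrightarrow> \<not> (A \<subseteq> V \<and> card A = q) \<Longrightarrow> c A = 0"
  by (auto simp: kchains_def)

lemma kchains_mem': "c \<in> kchains V H q \<Longrightarrow> 0 \<in> H \<Longrightarrow> c A \<in> H"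
  by (cases "A \<subseteq> V \<and> card A = q") (auto simp: kchains_def)

lemma kexactD:
  assumes "kexact V X G q D" "c \<in> kchains V (G (D - int q)) q" "kbd V X c = (\<lambda>_. 0)"
  obtains b where "b \<in> kchains V (G (D - int q - 1)) (Suc q)" "kbd V X b = c"
  using assms by (auto simp: kexact_def)

locale graded_koszul = koszul V X for V and X :: "nat \<Rightarrow> 'g::ab_group_add \<Rightarrow> 'g" +
  fixes G :: "int \<Rightarrow> 'g set"
  assumes G_0: "0 \<in> G d"
    and G_diff: "x \<in> G d \<Longrightarrow> y \<in> G d \<Longrightarrow> x - y \<in> G d"
    and G_X: "k \<in> V \<Longrightarrow> x \<in> G d \<Longrightarrow> X k x \<in> G (d + 1)"
begin

lemma G_uminus: "x \<in> G d \<Longrightarrow> - x \<in> G d"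
  using G_diff[OF G_0, of x d] by simp

lemma G_add: "x \<in> G d \<Longrightarrow> y \<in> G d \<Longrightarrow> x + y \<in> G d"
  using G_diff[OF _ G_uminus, of x d y] by simp

lemma G_sum: "(\<And>i. i \<in> I \<Longrightarrow> f i \<in> G d) \<Longrightarrow> sum f I \<in> G d"
  by (induction I rule: infinite_finite_induct) (auto simp: G_add G_0)

lemma G_ksgn: "x \<in> G d \<Longrightarrow> ksgn k B x \<in> G d"
  by (simp add: ksgn_def G_uminus)

lemma kchains_diff:
  "c \<in> kchains V (G d) q \<Longrightarrow> c' \<in> kchains V (G d) q \<Longrightarrow> (\<lambda>A. c A - c' A) \<in> kchains V (G d) q"
  by (auto simp: kchains_def G_diff)

lemma kbd_kchains:
  assumes c: "c \<in> kchains V (G d) (Suc q)"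
  shows "kbd V X c \<in> kchains V (G (d + 1)) q"
proof (rule kchainsI)
  fix A assume A: "A \<subseteq> V" "card A = q"
  then have "finite A" using finite_V finite_subset by blast
  then show "kbd V X c A \<in> G (d + 1)"
    using A by (auto simp: kbd_def intro!: G_sum G_ksgn G_X kchains_mem'[OF c G_0])
next
  fix A assume A: "\<not> (A \<subseteq> V \<and> card A = q)"
  show "kbd V X c A = 0"
  proof (cases "A \<subseteq> V")
    case True
    then have "finite A" using finite_V finite_subset by blast
    then have "c (insert k A) = 0" if "k \<in> V - A" for k
      using that A True by (intro kchains_0[OF c]) auto
    then show ?thesis by (simp add: kbd_def)
  qed (simp add: kbd_def)
qed

lemma kbd_0_chain:
  assumes c: "c \<in> kchains V (G d) 0"
  shows "kbd V X c = (\<lambda>_. 0)"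
proof
  fix A
  have "c (insert k A) = 0" if "A \<subseteq> V" for k
    using finite_subset[OF that finite_V] by (intro kchains_0[OF c]) auto
  then show "kbd V X c A = 0" by (simp add: kbd_def)
qed

end

text \<open>The map \<open>f\<close> is constrained only on the components \<open>G d\<close>: the
  differentials of a resolution are specified only on their free modules and are arbitrary functions
  elsewhere.\<close>

locale koszul_ses =
  F: graded_koszul V X G + Z': graded_koszul V Y G'
  for V and X :: "nat \<Rightarrow> 'g::ab_group_add \<Rightarrow> 'g" and G
    and Y :: "nat \<Rightarrow> 'h::ab_group_add \<Rightarrow> 'h" and G' +
  fixes f :: "'g \<Rightarrow> 'h"
  assumes f_add: "x \<in> G d \<Longrightarrow> y \<in> G d \<Longrightarrow> f (x + y) = f x + f y"
    and f_X: "k \<in> V \<Longrightarrow> x \<in> G d \<Longrightarrow> f (X k x) = Y k (f x)"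
    and f_onto: "f ` G d = G' d"
begin

abbreviation Z where "Z d \<equiv> {x \<in> G d. f x = 0}"

lemma f_0 [simp]: "f 0 = 0"
  using f_add[OF F.G_0 F.G_0] by simp

lemma f_uminus: "x \<in> G d \<Longrightarrow> f (- x) = - f x"
  using f_add[of x d "- x"] F.G_uminus[of x d] by (simp add: eq_neg_iff_add_eq_0 add.commute)

lemma f_diff: "x \<in> G d \<Longrightarrow> y \<in> G d \<Longrightarrow> f (x - y) = f x - f y"
  using f_add[of x d "- y"] F.G_uminus[of y d] by (simp add: f_uminus)

lemma f_sum: "(\<And>i. i \<in> I \<Longrightarrow> a i \<in> G d) \<Longrightarrow> f (sum a I) = (\<Sum>i\<in>I. f (a i))"
  by (induction I rule: infinite_finite_induct) (auto simp: F.G_sum f_add[where d = d])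

lemma f_ksgn: "x \<in> G d \<Longrightarrow> f (ksgn k B x) = ksgn k B (f x)"
  by (simp add: ksgn_def f_uminus)

sublocale Z: graded_koszul V X Z
proof
  show "0 \<in> Z d" for d
    using F.G_0 by simp
  show "x - y \<in> Z d" if "x \<in> Z d" "y \<in> Z d" for x y d
    using that f_diff[of x d y] F.G_diff by simp
  show "X k x \<in> Z (d + 1)" if "k \<in> V" "x \<in> Z d" for k x d
    using that f_X[of k x d] F.G_X by simp
qed

lemma map_kchains: "c \<in> kchains V (G d) q \<Longrightarrow> (\<lambda>A. f (c A)) \<in> kchains V (G' d) q"
  using f_onto[of d] by (auto simp: kchains_def)

lemma lift_kchains:
  assumes c: "c \<in> kchains V (G' d) q"
  obtains c0 where "c0 \<in> kchains V (G d) q" "\<And>A. f (c0 A) = c A"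
proof -
  have "\<exists>x. x \<in> G d \<and> f x = c A" if "A \<subseteq> V \<and> card A = q" for A
    using kchains_mem[OF c, of A] that f_onto[of d] by (metis imageE)
  then obtain g where g: "\<And>A. A \<subseteq> V \<and> card A = q \<Longrightarrow> g A \<in> G d \<and> f (g A) = c A" by metis
  show ?thesis
  proof
    show "(\<lambda>A. if A \<subseteq> V \<and> card A = q then g A else 0) \<in> kchains V (G d) q"
      using g by (auto simp: kchains_def)
    show "f (if A \<subseteq> V \<and> card A = q then g A else 0) = c A" for A
      using g[of A] kchains_0[OF c, of A] by auto
  qed
qed

lemma kbd_map:
  assumes c: "c \<in> kchains V (G d) q"
  shows "kbd V Y (\<lambda>A. f (c A)) = (\<lambda>A. f (kbd V X c A))"
proof
  fix A
  have cG: "c B \<in> G d" for B using kchains_mem'[OF c F.G_0] .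
  show "kbd V Y (\<lambda>A. f (c A)) A = f (kbd V X c A)"
  proof (cases "A \<subseteq> V")
    case True
    have "f (kbd V X c A) = (\<Sum>k\<in>V - A. f (ksgn k A (X k (c (insert k A)))))"
      using cG True by (auto simp: kbd_def intro!: f_sum[where d = "d + 1"] F.G_ksgn F.G_X)
    also have "\<dots> = kbd V Y (\<lambda>A. f (c A)) A"
      using True by (auto simp: kbd_def f_ksgn[OF F.G_X[OF _ cG]] f_X[OF _ cG] intro!: sum.cong)
    finally show ?thesis by simp
  qed (simp add: kbd_def)
qed

text \<open>The part H_(q+1)(G) -> H_(q+1)(G') -> H_q(Z) of the long exact sequence, as a diagram
  chase.\<close>

lemma kexact_step1:
  assumes F: "kexact V X G (Suc q) D" and Z: "kexact V X Z q D"
  shows "kexact V Y G' (Suc q) D"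
  unfolding kexact_def
proof safe
  fix c assume c: "c \<in> kchains V (G' (D - int (Suc q))) (Suc q)" and "kbd V Y c = (\<lambda>_. 0)"
  have e1: "D - int (Suc q) + 1 = D - int q" by simp
  obtain c0 where c0: "c0 \<in> kchains V (G (D - int (Suc q))) (Suc q)" "\<And>A. f (c0 A) = c A"
    using lift_kchains[OF c] by blast
  have "f (kbd V X c0 A) = 0" for A
    using fun_cong[OF kbd_map[OF c0(1)], of A] c0(2) \<open>kbd V Y c = _\<close> by simp
  moreover have "kbd V X c0 \<in> kchains V (G (D - int q)) q"
    using F.kbd_kchains[OF c0(1)] unfolding e1 .
  ultimately have "kbd V X c0 \<in> kchains V (Z (D - int q)) q"
    by (auto simp: kchains_def)
  then obtain b where b: "b \<in> kchains V (Z (D - int q - 1)) (Suc q)" "kbd V X b = kbd V X c0"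
    using kexactD[OF Z _ F.kbd_kbd] by blast
  have e2: "D - int q - 1 = D - int (Suc q)" by simp
  have bG: "b \<in> kchains V (G (D - int (Suc q))) (Suc q)"
    using b(1) unfolding kchains_def e2 by auto
  have fb: "f (b A) = 0" for A
    using kchains_mem'[OF b(1) Z.G_0, of A] by simp
  have "kbd V X (\<lambda>A. c0 A - b A) = (\<lambda>_. 0)"
    by (simp add: F.kbd_diff b(2))
  then obtain a where a: "a \<in> kchains V (G (D - int (Suc q) - 1)) (Suc (Suc q))"
      "kbd V X a = (\<lambda>A. c0 A - b A)"
    using kexactD[OF F F.kchains_diff[OF c0(1) bG]] by blast
  have "c0 A \<in> G (D - int (Suc q))" "b A \<in> G (D - int (Suc q))" for A
    using kchains_mem'[OF c0(1) F.G_0] kchains_mem'[OF bG F.G_0] by auto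
  then have "f (c0 A - b A) = c A" for A
    using f_diff[of "c0 A" "D - int (Suc q)" "b A"] c0(2) fb by simp
  then have "kbd V Y (\<lambda>A. f (a A)) = c"
    unfolding kbd_map[OF a(1)] a(2) by simp
  with map_kchains[OF a(1)]
  show "\<exists>b\<in>kchains V (G' (D - int (Suc q) - 1)) (Suc (Suc q)). kbd V Y b = c" by blast
qed

text \<open>The part H_(q+1)(G') -> H_q(Z) -> H_q(G) of the long exact sequence. Only the vanishing
  of the second map is assumed, because for \<open>q = 0\<close> the group H_0 of a free module is
  not zero; minimality will show that the map into it is.\<close>

lemma kexact_step2:
  assumes F: "\<And>z. z \<in> kchains V (Z (D - int q)) q \<Longrightarrow> kbd V X z = (\<lambda>_. 0) \<Longrightarrow>
      \<exists>a \<in> kchains V (G (D - int q - 1)) (Suc q). kbd V X a = z"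
    and Z': "kexact V Y G' (Suc q) D"
  shows "kexact V X Z q D"
  unfolding kexact_def
proof safe
  fix z assume z: "z \<in> kchains V (Z (D - int q)) q" and dz: "kbd V X z = (\<lambda>_. 0)"
  obtain a where a: "a \<in> kchains V (G (D - int q - 1)) (Suc q)" "kbd V X a = z"
    using F[OF z dz] by blast
  have e: "D - int q - 1 = D - int (Suc q)" by simp
  have fz: "f (z A) = 0" for A
    using kchains_mem'[OF z Z.G_0, of A] by simp
  have "kbd V Y (\<lambda>A. f (a A)) = (\<lambda>_. 0)"
    unfolding kbd_map[OF a(1)] a(2) using fz by simp
  then obtain b' where b': "b' \<in> kchains V (G' (D - int (Suc q) - 1)) (Suc (Suc q))"
      "kbd V Y b' = (\<lambda>A. f (a A))"
    using kexactD[OF Z' map_kchains[OF a(1)[unfolded e]]] by blast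
  obtain b where b: "b \<in> kchains V (G (D - int (Suc q) - 1)) (Suc (Suc q))" "\<And>A. f (b A) = b' A"
    using lift_kchains[OF b'(1)] by blast
  have db: "kbd V X b \<in> kchains V (G (D - int q - 1)) (Suc q)"
    using F.kbd_kchains[OF b(1)] by (simp add: algebra_simps)
  have fdb: "f (kbd V X b A) = f (a A)" for A
    using fun_cong[OF kbd_map[OF b(1)], of A] b(2) fun_cong[OF b'(2), of A] by simp
  have mem: "a A \<in> G (D - int q - 1)" "kbd V X b A \<in> G (D - int q - 1)" for A
    using kchains_mem'[OF a(1) F.G_0] kchains_mem'[OF db F.G_0] by auto
  have "(\<lambda>A. a A - kbd V X b A) \<in> kchains V (Z (D - int q - 1)) (Suc q)"
    using F.kchains_diff[OF a(1) db] f_diff[OF mem] fdb by (auto simp: kchains_def)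
  moreover have "kbd V X (\<lambda>A. a A - kbd V X b A) = z"
    by (simp add: F.kbd_diff F.kbd_kbd a(2))
  ultimately show "\<exists>b\<in>kchains V (Z (D - int q - 1)) (Suc q). kbd V X b = z" by blast
qed

end

section \<open>Acyclicity by cones, one multidegree at a time\<close>

lemma koszul_id: "finite V \<Longrightarrow> koszul V (\<lambda>_ x. x)"
  by standard auto

text \<open>The cone with apex \<open>v\<close> over the part of \<open>c\<close> supported on
  \<open>T\<close>. Subtracting its boundary from \<open>c\<close> erases the faces in
  \<open>T\<close> that avoid \<open>v\<close>.\<close>

definition cone_chain :: "nat \<Rightarrow> nat set set \<Rightarrow> (nat set \<Rightarrow> 'k::ab_group_add) \<Rightarrow> nat set \<Rightarrow> 'k" where
  "cone_chain v T c A = (if v \<in> A \<and> A - {v} \<in> T then ksgn v (A - {v}) (c (A - {v})) else 0)"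

lemma kbd_cone_chain:
  assumes V: "finite V" "v \<in> V" and B: "B \<subseteq> V" "v \<notin> B"
  shows "kbd V (\<lambda>_ x. x) (cone_chain v T c) B = (if B \<in> T then c B else 0)"
proof -
  have "kbd V (\<lambda>_ x. x) (cone_chain v T c) B
      = (\<Sum>k\<in>V - B. if k = v then (if B \<in> T then c B else 0) else 0)"
    unfolding kbd_def if_P[OF B(1)] using B by (intro sum.cong) (auto simp: cone_chain_def)
  also have "\<dots> = (if B \<in> T then c B else 0)"
    using V B by simp
  finally show ?thesis .
qed

text \<open>
  Two cones, with apexes \<open>v\<close> and \<open>w\<close>, suffice: the first removes from a cycle the faces without
  \<open>v\<close> and \<open>w\<close> that cannot be extended by \<open>w\<close>, the second removes those that can; the remaining
  cycle vanishes by the second condition.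
\<close>

lemma two_cone_acyclic:
  fixes c :: "nat set \<Rightarrow> 'k::ab_group_add"
  assumes V: "finite V" "v \<in> V" "w \<in> V"
    and down: "\<And>A B. P B \<Longrightarrow> A \<subseteq> B \<Longrightarrow> P A"
    and D1: "\<And>A. A \<subseteq> V \<Longrightarrow> card A = q \<Longrightarrow> P A \<Longrightarrow> v \<notin> A \<Longrightarrow> w \<notin> A \<Longrightarrow> P (insert v A) \<or> P (insert w A)"
    and D2: "\<And>A. A \<subseteq> V \<Longrightarrow> card A = q \<Longrightarrow> P A \<Longrightarrow> v \<in> A \<Longrightarrow> w \<notin> A \<Longrightarrow> P (insert w (A - {v})) \<Longrightarrow> P (insert w A)"
    and supp: "\<And>A. c A \<noteq> 0 \<Longrightarrow> A \<subseteq> V \<and> card A = q \<and> P A"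
    and cyc: "kbd V (\<lambda>_ x. x) c = (\<lambda>_. 0)"
  obtains b where "\<And>A. b A \<noteq> 0 \<Longrightarrow> A \<subseteq> V \<and> card A = Suc q \<and> P A" "kbd V (\<lambda>_ x. x) b = c"
proof -
  have K: "koszul V (\<lambda>_ x. x :: 'k)" by (rule koszul_id[OF V(1)])
  note kbd_add = koszul.kbd_add[OF K] and kbd_diff = koszul.kbd_diff[OF K]
    and kbd_kbd = koszul.kbd_kbd[OF K]
  let ?d = "kbd V (\<lambda>_ x. x :: 'k)"
  have cone: "(cone_chain u T c' A \<noteq> 0 \<longrightarrow> A \<subseteq> V \<and> card A = Suc q \<and> P A) \<and>
      (?d (cone_chain u T c') A \<noteq> 0 \<longrightarrow> A \<subseteq> V \<and> card A = q \<and> P A)"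
    if u: "u \<in> V" and supp': "\<And>A. c' A \<noteq> 0 \<Longrightarrow> A \<subseteq> V \<and> card A = q \<and> P A"
      and T: "\<And>A. A \<in> T \<Longrightarrow> c' A \<noteq> 0 \<Longrightarrow> P (insert u A)" for u T c' A
  proof -
    have 1: "A \<subseteq> V \<and> card A = Suc q \<and> P A" if nz: "cone_chain u T c' A \<noteq> 0" for A
    proof -
      have A: "u \<in> A" "A - {u} \<in> T" "c' (A - {u}) \<noteq> 0"
        using nz by (auto simp: cone_chain_def split: if_splits)
      have "A - {u} \<subseteq> V" "card (A - {u}) = q" using supp'[OF A(3)] by auto
      have fin: "finite (A - {u})" using finite_subset[OF \<open>A - {u} \<subseteq> V\<close> V(1)] .
      have eq: "insert u (A - {u}) = A" using A(1) by blast
      have "P A" using T[OF A(2,3)] unfolding eq .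
      moreover have "card A = Suc q"
        using card_insert_disjoint[OF fin, of u] \<open>card (A - {u}) = q\<close> unfolding eq by simp
      ultimately show ?thesis using \<open>A - {u} \<subseteq> V\<close> u by blast
    qed
    have 2: "A \<subseteq> V \<and> card A = q \<and> P A" if nz: "?d (cone_chain u T c') A \<noteq> 0"
    proof -
      have AV: "A \<subseteq> V" using nz by (auto simp: kbd_def split: if_splits)
      then obtain k where k: "k \<in> V - A" "cone_chain u T c' (insert k A) \<noteq> 0"
        using nz by (auto simp: kbd_def elim!: sum.not_neutral_contains_not_neutral)
      have "finite A" using finite_subset[OF AV V(1)] .
      with 1[OF k(2)] k(1) AV show ?thesis by (auto intro: down)
    qed
    show ?thesis using 1 2 by blast
  qed
  define T1 where "T1 = {B. w \<notin> B \<and> v \<notin> B \<and> \<not> P (insert w B)}"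
  define b1 where "b1 = cone_chain v T1 c"
  define c1 where "c1 A = c A - ?d b1 A" for A
  have T1: "P (insert v A)" if "A \<in> T1" "c A \<noteq> 0" for A
    using D1[of A] supp[OF that(2)] that(1) by (auto simp: T1_def)
  have cone1: "(b1 A \<noteq> 0 \<longrightarrow> A \<subseteq> V \<and> card A = Suc q \<and> P A) \<and>
      (?d b1 A \<noteq> 0 \<longrightarrow> A \<subseteq> V \<and> card A = q \<and> P A)" for A
    unfolding b1_def by (rule cone[OF V(2) supp]) (use T1 in auto)
  have supp1: "A \<subseteq> V \<and> card A = q \<and> P A" if "c1 A \<noteq> 0" for A
    using that supp[of A] cone1[where A = A] by (cases "c A = 0") (auto simp: c1_def)
  have c1: "v \<in> A \<or> w \<in> A \<or> P (insert w A)" if "c1 A \<noteq> 0" for A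
  proof (rule ccontr)
    assume "\<not> ?thesis"
    with that supp1[OF that] kbd_cone_chain[OF V(1,2), where B = A and T = T1 and c = c] show False
      by (auto simp: c1_def b1_def T1_def)
  qed
  define T2 where "T2 = {B. w \<notin> B \<and> P (insert w B)}"
  define b2 where "b2 = cone_chain w T2 c1"
  define c2 where "c2 A = c1 A - ?d b2 A" for A
  have T2: "P (insert w A)" if "A \<in> T2" "c1 A \<noteq> 0" for A
    using that(1) by (auto simp: T2_def)
  have cone2: "(b2 A \<noteq> 0 \<longrightarrow> A \<subseteq> V \<and> card A = Suc q \<and> P A) \<and>
      (?d b2 A \<noteq> 0 \<longrightarrow> A \<subseteq> V \<and> card A = q \<and> P A)" for A
    unfolding b2_def by (rule cone[OF V(3) supp1]) (use T2 in auto)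
  have supp2: "A \<subseteq> V \<and> card A = q \<and> P A" if "c2 A \<noteq> 0" for A
    using that supp1[of A] cone2[where A = A] by (cases "c1 A = 0") (auto simp: c2_def)
  have c2: "v \<in> A \<and> \<not> P (insert w A)" if "c2 A \<noteq> 0" "w \<notin> A" for A
    using that supp2[OF that(1)] kbd_cone_chain[OF V(1,3), where B = A and T = T2 and c = c1] c1[of A]
    by (auto simp: c2_def b2_def T2_def split: if_splits)
  have c2_eq: "c2 = (\<lambda>A. (c A - ?d b1 A) - ?d b2 A)"
    by (auto simp: c2_def c1_def)
  have cyc2: "?d c2 = (\<lambda>_. 0)"
    unfolding c2_eq kbd_diff kbd_kbd cyc by simp
  have w_mem: "w \<in> A" if nz: "c2 A \<noteq> 0" for A
  proof (rule ccontr)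
    assume wA: "w \<notin> A"
    with c2[OF nz] have vA: "v \<in> A" and nP: "\<not> P (insert w A)" by auto
    note A = supp2[OF nz]
    define B where "B = A - {v}"
    have BV: "B \<subseteq> V" using A by (auto simp: B_def)
    have vw: "v \<noteq> w" using vA wA by auto
    \<comment> \<open>Of the faces obtained by adding one vertex to \<open>B\<close>, those without
      both \<open>v\<close> and \<open>w\<close> are outside the support of \<open>c2\<close>. Two
      terms remain, and their cancellation forces \<open>insert w B\<close> to be a face, which is
      the situation of \<open>D2\<close>.\<close>
    have "0 = ?d c2 B" using cyc2 by simp
    also have "\<dots> = (\<Sum>k\<in>V - B. ksgn k B (c2 (insert k B)))"
      using BV by (simp add: kbd_def)
    also have "\<dots> = (\<Sum>k\<in>{v, w}. ksgn k B (c2 (insert k B)))"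
    proof (rule sum.mono_neutral_right)
      show "finite (V - B)" "{v, w} \<subseteq> V - B" using V wA by (auto simp: B_def)
      show "\<forall>k\<in>V - B - {v, w}. ksgn k B (c2 (insert k B)) = 0"
        using c2 wA by (auto simp: B_def)
    qed
    also have "\<dots> = ksgn v B (c2 A) + ksgn w B (c2 (insert w B))"
      using vw vA by (simp add: B_def insert_absorb)
    finally have "c2 (insert w B) \<noteq> 0" using nz by auto
    then have "P (insert w (A - {v}))" using supp2 by (auto simp: B_def)
    with D2 A vA wA nP show False by blast
  qed
  \<comment> \<open>Now all faces in the support contain \<open>w\<close>, so the boundary at
    \<open>A - {w}\<close> has the single term coming from \<open>A\<close>.\<close>
  have "c2 A = 0" for A
  proof (rule ccontr)
    assume nz: "c2 A \<noteq> 0"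
    note A = supp2[OF nz] and wA = w_mem[OF nz]
    define B where "B = A - {w}"
    have BV: "B \<subseteq> V" using A by (auto simp: B_def)
    have "0 = ?d c2 B" using cyc2 by simp
    also have "\<dots> = (\<Sum>k\<in>V - B. ksgn k B (c2 (insert k B)))"
      using BV by (simp add: kbd_def)
    also have "\<dots> = (\<Sum>k\<in>{w}. ksgn k B (c2 (insert k B)))"
    proof (rule sum.mono_neutral_right)
      show "finite (V - B)" "{w} \<subseteq> V - B" using V by (auto simp: B_def)
      show "\<forall>k\<in>V - B - {w}. ksgn k B (c2 (insert k B)) = 0"
        using w_mem by (auto simp: B_def)
    qed
    also have "\<dots> = ksgn w B (c2 A)"
      using wA by (simp add: B_def insert_absorb)
    finally show False using nz by (metis ksgn_eq_0_iff)
  qed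
  then have eq: "c A = ?d b1 A + ?d b2 A" for A
    unfolding c2_eq by (metis add.commute diff_diff_eq right_minus_eq)
  show thesis
  proof
    show "A \<subseteq> V \<and> card A = Suc q \<and> P A" if "b1 A + b2 A \<noteq> 0" for A
      using that cone1[where A = A] cone2[where A = A] by (cases "b1 A = 0") auto
    show "?d (\<lambda>A. b1 A + b2 A) = c"
      unfolding kbd_add using eq by auto
  qed
qed

text \<open>
  The functional \<open>L y A\<close> reads off the coefficient of an element in the multidegree
  \<open>y\<close> minus the sum of the degrees of the variables in \<open>A\<close>; thus for fixed \<open>y\<close> the
  Koszul complex becomes the simplicial chain complex of \<open>{A. P y A}\<close>.
\<close>

lemma (in graded_koszul) kexact_multigraded:
  fixes L :: "'y \<Rightarrow> nat set \<Rightarrow> 'g \<Rightarrow> 'k::ab_group_add"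
  assumes L_add: "\<And>y A g g'. L y A (g + g') = L y A g + L y A g'"
    and L_X: "\<And>y B k g. B \<subseteq> V \<Longrightarrow> k \<in> V - B \<Longrightarrow> L y B (X k g) = L y (insert k B) g"
    and L_sep: "\<And>A g g'. A \<subseteq> V \<Longrightarrow> (\<And>y. L y A g = L y A g') \<Longrightarrow> g = g'"
    and L_supp: "\<And>y A g. A \<subseteq> V \<Longrightarrow> card A = q \<Longrightarrow> g \<in> G (D - int q) \<Longrightarrow> L y A g \<noteq> 0 \<Longrightarrow> P y A"
    and L_onto: "\<And>A \<beta>. A \<subseteq> V \<Longrightarrow> card A = Suc q \<Longrightarrow> (\<And>y. \<beta> y \<noteq> 0 \<Longrightarrow> P y A) \<Longrightarrow>
        \<exists>g \<in> G (D - int q - 1). \<forall>y. L y A g = \<beta> y"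
    and vw: "\<And>y. v y \<in> V" "\<And>y. w y \<in> V"
    and down: "\<And>y A B. P y B \<Longrightarrow> A \<subseteq> B \<Longrightarrow> P y A"
    and D1: "\<And>y A. A \<subseteq> V \<Longrightarrow> card A = q \<Longrightarrow> P y A \<Longrightarrow> v y \<notin> A \<Longrightarrow> w y \<notin> A \<Longrightarrow>
        P y (insert (v y) A) \<or> P y (insert (w y) A)"
    and D2: "\<And>y A. A \<subseteq> V \<Longrightarrow> card A = q \<Longrightarrow> P y A \<Longrightarrow> v y \<in> A \<Longrightarrow> w y \<notin> A \<Longrightarrow>
        P y (insert (w y) (A - {v y})) \<Longrightarrow> P y (insert (w y) A)"
  shows "kexact V X G q D"
  unfolding kexact_def
proof safe
  fix c assume c: "c \<in> kchains V (G (D - int q)) q" and dc: "kbd V X c = (\<lambda>_. 0)"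
  have L_0 [simp]: "L y A 0 = 0" for y A
    using L_add[of y A 0 0] by simp
  have L_uminus: "L y A (- g) = - L y A g" for y A g
    using L_add[of y A g "- g"] by (simp add: eq_neg_iff_add_eq_0 add.commute)
  have L_ksgn: "L y A (ksgn k B g) = ksgn k B (L y A g)" for y A k B g
    by (simp add: ksgn_def L_uminus)
  have L_sum: "L y A (sum a I) = (\<Sum>i\<in>I. L y A (a i))" for y A I and a :: "nat \<Rightarrow> 'g"
    by (induction I rule: infinite_finite_induct) (auto simp: L_add)
  have L_kbd: "kbd V (\<lambda>_ x. x) (\<lambda>A. L y A (a A)) B = L y B (kbd V X a B)" for y a B
    by (auto simp: kbd_def L_sum L_ksgn L_X intro!: sum.cong)
  have "\<exists>b. (\<forall>A. b A \<noteq> 0 \<longrightarrow> A \<subseteq> V \<and> card A = Suc q \<and> P y A) \<and>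
      kbd V (\<lambda>_ x. x) b = (\<lambda>A. L y A (c A))" for y
  proof -
    have supp: "A \<subseteq> V \<and> card A = q \<and> P y A" if nz: "L y A (c A) \<noteq> 0" for A
    proof -
      have A: "A \<subseteq> V \<and> card A = q" using kchains_0[OF c, of A] nz by (metis L_0)
      moreover have "P y A" using A L_supp[OF _ _ kchains_mem[OF c] nz] by blast
      ultimately show ?thesis by blast
    qed
    have cyc: "kbd V (\<lambda>_ x. x) (\<lambda>A. L y A (c A)) = (\<lambda>_. 0)"
      using L_kbd[of y c] dc by auto
    show ?thesis
      by (rule two_cone_acyclic[OF finite_V vw(1)[of y] vw(2)[of y] down D1 D2 supp cyc]) blast+
  qed
  then obtain b where b: "\<And>y A. b y A \<noteq> 0 \<Longrightarrow> A \<subseteq> V \<and> card A = Suc q \<and> P y A"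
    "\<And>y. kbd V (\<lambda>_ x. x) (b y) = (\<lambda>A. L y A (c A))" by metis
  \<comment> \<open>The fillings found separately for each multidegree \<open>y\<close> are glued to
    a single ring or module element for each \<open>A\<close>.\<close>
  have "\<exists>g \<in> G (D - int q - 1). \<forall>y. L y A g = b y A" if "A \<subseteq> V \<and> card A = Suc q" for A
    using L_onto[of A "\<lambda>y. b y A"] b(1) that by blast
  then obtain g where g: "\<And>A. A \<subseteq> V \<and> card A = Suc q \<Longrightarrow>
      g A \<in> G (D - int q - 1) \<and> (\<forall>y. L y A (g A) = b y A)" by metis
  define a where "a A = (if A \<subseteq> V \<and> card A = Suc q then g A else 0)" for A
  have a: "a \<in> kchains V (G (D - int q - 1)) (Suc q)"
    using g by (auto simp: kchains_def a_def)
  have La: "(\<lambda>A. L y A (a A)) = b y" for y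
  proof
    show "L y A (a A) = b y A" for A
      using g[of A] b(1)[of y A] by (auto simp: a_def)
  qed
  have "kbd V X a B = c B" for B
  proof (cases "B \<subseteq> V")
    case True
    then show ?thesis
      by (rule L_sep) (simp add: L_kbd[symmetric] La b(2))
  next
    case False
    then show ?thesis using kchains_0[OF c] by (simp add: kbd_def)
  qed
  with a show "\<exists>b\<in>kchains V (G (D - int q - 1)) (Suc q). kbd V X b = c" by blast
qed

section \<open>Graded free modules\<close>

lemma lookup_Var_mult:
  "Poly_Mapping.lookup (Var k * p) t =
    (if k \<in> Poly_Mapping.keys t then Poly_Mapping.lookup p (t - Poly_Mapping.single k 1) else 0)"
proof -
  let ?s = "Poly_Mapping.single k (1::nat)"
  have *: "t = ?s + q \<longleftrightarrow> k \<in> Poly_Mapping.keys t \<and> q = t - ?s" for q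
  proof
    assume "k \<in> Poly_Mapping.keys t \<and> q = t - ?s"
    then show "t = ?s + q"
      by (intro poly_mapping_eqI)
        (auto simp: lookup_add lookup_minus lookup_single in_keys_iff when_def)
  qed (auto simp: in_keys_iff lookup_add)
  have "Poly_Mapping.lookup (Var k * p) t
      = (\<Sum>l. (\<Sum>q. Poly_Mapping.lookup p q when t = ?s + q) when l = ?s)"
    unfolding Var_def lookup_mult lookup_single
    by (intro Sum_any.cong) (auto simp: when_def)
  also have "\<dots> = (\<Sum>q. Poly_Mapping.lookup p q when t = ?s + q)"
    by simp
  also have "\<dots> = (if k \<in> Poly_Mapping.keys t then Poly_Mapping.lookup p (t - ?s) else 0)"
    unfolding * by (cases "k \<in> Poly_Mapping.keys t") auto
  finally show ?thesis .
qed

definition sqfree_mon :: "nat set \<Rightarrow> nat \<Rightarrow>\<^sub>0 nat" where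
  "sqfree_mon A = (\<Sum>k\<in>A. Poly_Mapping.single k 1)"

lemma lookup_sqfree_mon: "finite A \<Longrightarrow> Poly_Mapping.lookup (sqfree_mon A) i = (if i \<in> A then 1 else 0)"
  by (simp add: sqfree_mon_def lookup_sum lookup_single when_def)

lemma mon_deg_eq_sum:
  "finite A \<Longrightarrow> Poly_Mapping.keys t \<subseteq> A \<Longrightarrow> mon_deg t = (\<Sum>i\<in>A. Poly_Mapping.lookup t i)"
  unfolding mon_deg_def by (intro sum.mono_neutral_left) (auto simp: in_keys_iff)

lemma mon_deg_0 [simp]: "mon_deg 0 = 0"
  by (simp add: mon_deg_def)

lemma mon_deg_add: "mon_deg (s + t) = mon_deg s + mon_deg t"
proof -
  let ?A = "Poly_Mapping.keys s \<union> Poly_Mapping.keys t"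
  have "Poly_Mapping.keys (s + t) \<subseteq> ?A" by (rule keys_add)
  then show ?thesis
    by (subst (1 2 3) mon_deg_eq_sum[of ?A]) (auto simp: lookup_add sum.distrib)
qed

lemma mon_deg_single [simp]: "mon_deg (Poly_Mapping.single k a) = a"
  by (cases "a = 0") (auto simp: mon_deg_def)

lemma mon_deg_sqfree_mon: "mon_deg (sqfree_mon A) = card A"
  by (induction A rule: infinite_finite_induct) (auto simp: sqfree_mon_def mon_deg_add)

lemma keys_nat_add: "Poly_Mapping.keys (s + t :: nat \<Rightarrow>\<^sub>0 nat) = Poly_Mapping.keys s \<union> Poly_Mapping.keys t"
  by (auto simp: in_keys_iff lookup_add)

lemma lookup_le_mon_deg: "Poly_Mapping.lookup t i \<le> mon_deg t"
proof (cases "i \<in> Poly_Mapping.keys t")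
  case True
  then show ?thesis unfolding mon_deg_def by (intro member_le_sum) auto
qed (simp add: in_keys_iff)

lemma finite_monomials: "finite {t. Poly_Mapping.keys t \<subseteq> {1..N} \<and> mon_deg t \<le> d}" (is "finite ?S")
proof (rule finite_imageD)
  have "Poly_Mapping.lookup ` ?S \<subseteq> {f. \<forall>i. (i \<in> {1..N} \<longrightarrow> f i \<in> {..d}) \<and> (i \<notin> {1..N} \<longrightarrow> f i = 0)}"
    using lookup_le_mon_deg by (auto simp: in_keys_iff intro: order_trans)
  moreover have "finite {f. \<forall>i. (i \<in> {1..N} \<longrightarrow> f i \<in> {..d}) \<and> (i \<notin> {1..N} \<longrightarrow> f i = (0::nat))}"
    by (rule finite_set_of_finite_funs) auto
  ultimately show "finite (Poly_Mapping.lookup ` ?S)" by (rule finite_subset)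
  show "inj_on Poly_Mapping.lookup ?S" by (auto intro!: inj_onI poly_mapping_eqI)
qed

lemma sqfree_mon_minus_add:
  assumes "finite A" "A \<subseteq> Poly_Mapping.keys t"
  shows "t - sqfree_mon A + sqfree_mon A = t"
proof (rule poly_mapping_eqI)
  fix i
  have "1 \<le> Poly_Mapping.lookup t i" if "i \<in> A" using that assms(2) by (auto simp: in_keys_iff)
  then show "Poly_Mapping.lookup (t - sqfree_mon A + sqfree_mon A) i = Poly_Mapping.lookup t i"
    using assms(1) by (auto simp: lookup_add lookup_minus lookup_sqfree_mon)
qed

definition vec_mult :: "nat \<Rightarrow> (nat \<Rightarrow> 'k::comm_ring_1 mpoly) \<Rightarrow> nat \<Rightarrow> 'k mpoly" where
  "vec_mult k x = (\<lambda>j. Var k * x j)"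

definition free_comp :: "nat \<Rightarrow> nat \<Rightarrow> (nat \<Rightarrow> int) \<Rightarrow> int \<Rightarrow> (nat \<Rightarrow> 'k::comm_ring_1 mpoly) set" where
  "free_comp N b e d = {x \<in> free_mod N b. homog_vec e d x}"

lemma free_comp_iff: "x \<in> free_comp N b e d \<longleftrightarrow>
    (\<forall>j t. Poly_Mapping.lookup (x j) t \<noteq> 0 \<longrightarrow>
      j \<in> {1..b} \<and> Poly_Mapping.keys t \<subseteq> {1..N} \<and> int (mon_deg t) = d - e j)"
  (is "?l \<longleftrightarrow> ?r")
proof
  assume l: ?l
  show ?r
  proof (intro allI impI)
    fix j t assume nz: "Poly_Mapping.lookup (x j) t \<noteq> 0"
    then have t: "t \<in> Poly_Mapping.keys (x j)" by (simp add: in_keys_iff)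
    have "x j \<noteq> 0" using nz by auto
    then have "j \<in> {1..b}" using l unfolding free_comp_def free_mod_def by blast
    moreover have "Poly_Mapping.keys t \<subseteq> {1..N}"
      using l t unfolding free_comp_def free_mod_def poly_ring_def by blast
    moreover have "int (mon_deg t) = d - e j"
      using l t unfolding free_comp_def homog_vec_def homog_poly_def by blast
    ultimately show "j \<in> {1..b} \<and> Poly_Mapping.keys t \<subseteq> {1..N} \<and> int (mon_deg t) = d - e j"
      by blast
  qed
next
  assume r: ?r
  have "x j = 0" if "j \<notin> {1..b}" for j
    using r that by (intro poly_mapping_eqI) auto
  moreover have "x j \<in> poly_ring N" "homog_poly (d - e j) (x j)" for j
    using r by (auto simp: poly_ring_def homog_poly_def in_keys_iff[of _ "x j"])
  ultimately show ?l
    by (simp add: free_comp_def free_mod_def homog_vec_def)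
qed

lemma free_comp_graded: "graded_koszul {1..N} vec_mult (free_comp N b e)"
proof
  show "vec_mult k (x + y) = vec_mult k x + vec_mult k y" for k and x y :: "nat \<Rightarrow> 'a mpoly"
    by (simp add: vec_mult_def fun_eq_iff algebra_simps)
  show "vec_mult k (vec_mult l x) = vec_mult l (vec_mult k x)" for k l and x :: "nat \<Rightarrow> 'a mpoly"
    by (simp add: vec_mult_def fun_eq_iff algebra_simps)
  show "0 \<in> free_comp N b e d" for d
    by (simp add: free_comp_iff)
  show "x - y \<in> free_comp N b e d" if "x \<in> free_comp N b e d" "y \<in> free_comp N b e d"
    for x y :: "nat \<Rightarrow> 'a mpoly" and d
    using that unfolding free_comp_iff by (simp add: lookup_minus) (metis diff_self)
  show "vec_mult k x \<in> free_comp N b e (d + 1)" if k: "k \<in> {1..N}" and x: "x \<in> free_comp N b e d"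
    for k d and x :: "nat \<Rightarrow> 'a mpoly"
    unfolding free_comp_iff
  proof (intro allI impI)
    fix j t assume "Poly_Mapping.lookup (vec_mult k x j) t \<noteq> 0"
    then have kt: "k \<in> Poly_Mapping.keys t"
      and nz: "Poly_Mapping.lookup (x j) (t - Poly_Mapping.single k 1) \<noteq> 0"
      by (auto simp: vec_mult_def lookup_Var_mult split: if_splits)
    define s where "s = t - Poly_Mapping.single k 1"
    have t: "t = s + Poly_Mapping.single k 1"
      using sqfree_mon_minus_add[of "{k}" t] kt by (simp add: s_def sqfree_mon_def)
    show "j \<in> {1..b} \<and> Poly_Mapping.keys t \<subseteq> {1..N} \<and> int (mon_deg t) = d + 1 - e j"
      using nz[folded s_def] x k unfolding t free_comp_iff by (auto simp: mon_deg_add keys_nat_add)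
  qed
qed simp

text \<open>For a free module the multidegree consists of a coordinate \<open>j\<close> and a
  monomial \<open>t\<close>, and the complex is the full simplex on the variables dividing
  \<open>t\<close>. It is a cone over any of these variables, so both apexes may coincide.\<close>

lemma free_comp_kexact:
  assumes N: "N \<ge> 1" and q: "q \<ge> 1"
  shows "kexact {1..N} vec_mult (free_comp N b e :: int \<Rightarrow> (nat \<Rightarrow> 'k::comm_ring_1 mpoly) set) q D"
proof -
  interpret graded_koszul "{1..N}" vec_mult "free_comp N b e :: int \<Rightarrow> (nat \<Rightarrow> 'k mpoly) set"
    by (rule free_comp_graded)
  \<comment> \<open>The case distinction is needed since subtraction of exponents truncates: without
    it a monomial not divisible by the product over \<open>A\<close> would contribute.\<close>
  define L :: "nat \<times> (nat \<Rightarrow>\<^sub>0 nat) \<Rightarrow> nat set \<Rightarrow> (nat \<Rightarrow> 'k mpoly) \<Rightarrow> 'k" where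
    "L = (\<lambda>(j, t) A g. if A \<subseteq> Poly_Mapping.keys t then Poly_Mapping.lookup (g j) (t - sqfree_mon A) else 0)"
  define P where "P = (\<lambda>(j, t) A. A \<subseteq> Poly_Mapping.keys t \<and> Poly_Mapping.keys t \<subseteq> {1..N} \<and>
    int (mon_deg t) = D - e j \<and> j \<in> {1..b})"
  define v where "v = (\<lambda>(j::nat, t::nat \<Rightarrow>\<^sub>0 nat). if Poly_Mapping.keys t \<inter> {1..N} = {} then 1
    else SOME k. k \<in> Poly_Mapping.keys t \<inter> {1..N})"
  have v: "v (j, t) \<in> {1..N} \<and> (Poly_Mapping.keys t \<inter> {1..N} \<noteq> {} \<longrightarrow> v (j, t) \<in> Poly_Mapping.keys t)" for j t
    using N some_in_eq[of "Poly_Mapping.keys t \<inter> {1..N}"] by (auto simp: v_def)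
  show ?thesis
  proof (rule kexact_multigraded[where L = L and P = P and v = v and w = v])
    show "L y A (g + g') = L y A g + L y A g'" for y A g g'
      by (simp add: L_def lookup_add split: prod.splits)
  next
    fix y :: "nat \<times> (nat \<Rightarrow>\<^sub>0 nat)" and B k and g :: "nat \<Rightarrow> 'k mpoly"
    assume B: "B \<subseteq> {1..N}" "k \<in> {1..N} - B"
    obtain j t where y: "y = (j, t)" by force
    have fin: "finite B" using finite_subset[OF B(1)] by simp
    have "k \<in> Poly_Mapping.keys (t - sqfree_mon B) \<longleftrightarrow> k \<in> Poly_Mapping.keys t"
      using B fin by (simp add: in_keys_iff lookup_minus lookup_sqfree_mon)
    moreover have "t - sqfree_mon B - Poly_Mapping.single k 1 = t - sqfree_mon (insert k B)"
      using B fin by (simp add: sqfree_mon_def diff_diff_eq add.commute)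
    ultimately show "L y B (vec_mult k g) = L y (insert k B) g"
      by (auto simp: L_def y vec_mult_def lookup_Var_mult)
  next
    fix A and g g' :: "nat \<Rightarrow> 'k mpoly"
    assume A: "A \<subseteq> {1..N}" and eq: "\<And>y. L y A g = L y A g'"
    have fin: "finite A" using finite_subset[OF A] by simp
    show "g = g'"
    proof (intro ext poly_mapping_eqI)
      fix j s
      have "A \<subseteq> Poly_Mapping.keys (s + sqfree_mon A)"
        using fin by (auto simp: in_keys_iff lookup_add lookup_sqfree_mon)
      then show "Poly_Mapping.lookup (g j) s = Poly_Mapping.lookup (g' j) s"
        using eq[of "(j, s + sqfree_mon A)"] by (simp add: L_def)
    qed
  next
    fix y A and g :: "nat \<Rightarrow> 'k mpoly"
    assume A: "A \<subseteq> {1..N}" "card A = q" and g: "g \<in> free_comp N b e (D - int q)" and nz: "L y A g \<noteq> 0"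
    obtain j t where y: "y = (j, t)" by force
    have fin: "finite A" using finite_subset[OF A(1)] by simp
    have At: "A \<subseteq> Poly_Mapping.keys t" and nz': "Poly_Mapping.lookup (g j) (t - sqfree_mon A) \<noteq> 0"
      using nz by (auto simp: L_def y split: if_splits)
    define s where "s = t - sqfree_mon A"
    have t: "t = s + sqfree_mon A"
      using sqfree_mon_minus_add[OF fin At] by (simp add: s_def)
    have s: "j \<in> {1..b}" "Poly_Mapping.keys s \<subseteq> {1..N}" "int (mon_deg s) = D - int q - e j"
      using g nz' unfolding s_def[symmetric] free_comp_iff by blast+
    have "Poly_Mapping.keys t \<subseteq> {1..N}"
      using s A fin unfolding t by (auto simp: keys_nat_add in_keys_iff lookup_sqfree_mon split: if_splits)
    moreover have "int (mon_deg t) = D - e j"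
      using s A unfolding t by (simp add: mon_deg_add mon_deg_sqfree_mon)
    ultimately show "P y A" using At s by (simp add: P_def y)
  next
    fix A \<beta>
    assume A: "A \<subseteq> {1..N}" "card A = Suc q" and \<beta>: "\<And>y. \<beta> y \<noteq> (0::'k) \<Longrightarrow> P y A"
    have fin: "finite A" using finite_subset[OF A(1)] by simp
    define g where "g j = Abs_poly_mapping (\<lambda>s. \<beta> (j, s + sqfree_mon A))" for j
    have lookup_g: "Poly_Mapping.lookup (g j) s = \<beta> (j, s + sqfree_mon A)" for j s
    proof -
      have "{s. \<beta> (j, s + sqfree_mon A) \<noteq> 0} \<subseteq>
          {t. Poly_Mapping.keys t \<subseteq> {1..N} \<and> mon_deg t \<le> nat (D - e j)}"
        using \<beta> by (force simp: P_def keys_nat_add mon_deg_add)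
      then have "finite {s. \<beta> (j, s + sqfree_mon A) \<noteq> 0}"
        using finite_monomials finite_subset by blast
      then show ?thesis by (simp add: g_def)
    qed
    have "g \<in> free_comp N b e (D - int q - 1)"
      unfolding free_comp_iff lookup_g
      using \<beta> A by (force simp: P_def keys_nat_add mon_deg_add mon_deg_sqfree_mon)
    moreover have "L (j, t) A g = \<beta> (j, t)" for j t
      using \<beta>[of "(j, t)"] sqfree_mon_minus_add[OF fin, of t] by (auto simp: L_def lookup_g P_def)
    ultimately show "\<exists>g\<in>free_comp N b e (D - int q - 1). \<forall>y. L y A g = \<beta> y" by auto
  next
    show "v y \<in> {1..N}" "v y \<in> {1..N}" for y using v by (cases y, simp)+
    show "P y A" if "P y B" "A \<subseteq> B" for y A B using that by (auto simp: P_def)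
    show "P y (insert (v y) A) \<or> P y (insert (v y) A)" if "card A = q" "P y A" for y A
    proof -
      obtain j t where y: "y = (j, t)" by force
      \<comment> \<open>This is where \<open>q \<ge> 1\<close> matters: for \<open>t = 0\<close>
        there is no variable to serve as apex, which reflects the nonzero H_0.\<close>
      have "A \<noteq> {}" using that q by auto
      then show ?thesis using that v[of j t] by (auto simp: P_def y)
    qed
  qed auto
qed

section \<open>Semigroup modules\<close>

text \<open>A component of a semigroup ring is encoded by coefficient functions of the weight, the
  exponent of \<open>u\<close>; together with the degree this fixes the exponent of
  \<open>v\<close>. Multiplication by a variable is then a translation, the same in all
  degrees.\<close>

definition shift_fun :: "(nat \<Rightarrow> int) \<Rightarrow> nat \<Rightarrow> (int \<Rightarrow> 'k) \<Rightarrow> int \<Rightarrow> 'k" where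
  "shift_fun \<mu> k g = (\<lambda>x. g (x - \<mu> k))"

definition supp_comp :: "(int \<Rightarrow> int \<Rightarrow> bool) \<Rightarrow> int \<Rightarrow> (int \<Rightarrow> 'k::zero) set" where
  "supp_comp S d = {g. \<forall>x. g x \<noteq> 0 \<longrightarrow> S d x}"

text \<open>
  \<open>S \<delta> x\<close> says that the degree \<open>\<delta>\<close> component of the module is nonzero in the weight \<open>x\<close>.
\<close>

locale semigroup_module =
  fixes V :: "nat set" and \<mu> :: "nat \<Rightarrow> int" and S :: "int \<Rightarrow> int \<Rightarrow> bool"
  assumes fin_V: "finite V"
    and S_add: "k \<in> V \<Longrightarrow> S d x \<Longrightarrow> S (d + 1) (x + \<mu> k)"
begin

lemma supp_comp_graded:
  "graded_koszul V (shift_fun \<mu>) (supp_comp S :: int \<Rightarrow> (int \<Rightarrow> 'k::ab_group_add) set)"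
proof
  show "finite V" by (rule fin_V)
  show "shift_fun \<mu> k (x + y) = shift_fun \<mu> k x + shift_fun \<mu> k y" for k and x y :: "int \<Rightarrow> 'k"
    by (simp add: shift_fun_def fun_eq_iff)
  show "shift_fun \<mu> k (shift_fun \<mu> l x) = shift_fun \<mu> l (shift_fun \<mu> k x)" for k l and x :: "int \<Rightarrow> 'k"
    by (simp add: shift_fun_def fun_eq_iff algebra_simps)
  show "(0 :: int \<Rightarrow> 'k) \<in> supp_comp S d" for d
    by (simp add: supp_comp_def)
  show "x - y \<in> supp_comp S d" if "x \<in> supp_comp S d" "y \<in> supp_comp S d" for x y :: "int \<Rightarrow> 'k" and d
    using that unfolding supp_comp_def by (simp, metis diff_self)
  show "shift_fun \<mu> k x \<in> supp_comp S (d + 1)" if "k \<in> V" "x \<in> supp_comp S d" for k d and x :: "int \<Rightarrow> 'k"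
  proof -
    have "S (d + 1) y" if "x (y - \<mu> k) \<noteq> 0" for y
      using S_add[OF \<open>k \<in> V\<close>, of d "y - \<mu> k"] that \<open>x \<in> _\<close> by (auto simp: supp_comp_def)
    then show ?thesis by (auto simp: supp_comp_def shift_fun_def)
  qed
qed

lemma S_add_sum: "finite C \<Longrightarrow> C \<subseteq> V \<Longrightarrow> S d x \<Longrightarrow> S (d + int (card C)) (x + sum \<mu> C)"
proof (induction C rule: finite_induct)
  case (insert k C)
  then have "S (d + int (card C) + 1) (x + sum \<mu> C + \<mu> k)" by (intro S_add) auto
  then show ?case using insert by (simp add: algebra_simps)
qed simp

text \<open>Modulo the variable \<open>w\<close>, assumption \<open>a\<close> says that
  \<open>v\<close> is surjective and \<open>b\<close> that it is injective in the degrees above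
  \<open>r\<close>. A face with \<open>q\<close> elements leaves a residual monomial of degree
  \<open>D - int q\<close>; applied to it, \<open>a\<close> becomes the first and \<open>b\<close>
  the second condition of the two cones.\<close>

lemma supp_comp_kexact:
  assumes vw: "v \<in> V" "w \<in> V" and r: "D - int q > r"
    and a: "\<And>d x. d > r \<Longrightarrow> S d x \<Longrightarrow> S (d - 1) (x - \<mu> v) \<or> S (d - 1) (x - \<mu> w)"
    and b: "\<And>d x. d > r \<Longrightarrow> S d x \<Longrightarrow> S d (x + \<mu> v - \<mu> w) \<Longrightarrow> S (d - 1) (x - \<mu> w)"
  shows "kexact V (shift_fun \<mu>) (supp_comp S :: int \<Rightarrow> (int \<Rightarrow> 'k::ab_group_add) set) q D"
proof -
  interpret graded_koszul V "shift_fun \<mu>" "supp_comp S :: int \<Rightarrow> (int \<Rightarrow> 'k) set"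
    by (rule supp_comp_graded)
  define L where "L = (\<lambda>y A (g :: int \<Rightarrow> 'k). g (y - sum \<mu> A))"
  define P where "P = (\<lambda>y A. A \<subseteq> V \<and> S (D - int (card A)) (y - sum \<mu> A))"
  have ins: "sum \<mu> (insert k A) = sum \<mu> A + \<mu> k" "card (insert k A) = Suc (card A)"
    if "A \<subseteq> V" "k \<notin> A" for k A
    using that finite_subset[OF that(1) fin_V] by auto
  show ?thesis
  proof (rule kexact_multigraded[where L = L and P = P and v = "\<lambda>_. v" and w = "\<lambda>_. w"])
    show "L y A (g + g') = L y A g + L y A g'" for y A g g'
      by (simp add: L_def)
    show "L y B (shift_fun \<mu> k g) = L y (insert k B) g" if "B \<subseteq> V" "k \<in> V - B" for y B k g
      using that ins[of B k] by (simp add: L_def shift_fun_def algebra_simps)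
    show "g = g'" if "\<And>y. L y A g = L y A g'" for A g g'
    proof
      show "g x = g' x" for x using that[of "x + sum \<mu> A"] by (simp add: L_def)
    qed
    show "P y A" if "A \<subseteq> V" "card A = q" "g \<in> supp_comp S (D - int q)" "L y A g \<noteq> 0" for y A g
      using that by (auto simp: P_def L_def supp_comp_def)
    show "\<exists>g\<in>supp_comp S (D - int q - 1). \<forall>y. L y A g = \<beta> y"
      if "A \<subseteq> V" "card A = Suc q" and \<beta>: "\<And>y. \<beta> y \<noteq> 0 \<Longrightarrow> P y A" for A and \<beta> :: "int \<Rightarrow> 'k"
    proof
      have "S (D - int q - 1) x" if "\<beta> (x + sum \<mu> A) \<noteq> 0" for x
        using \<beta>[OF that] \<open>card A = _\<close> by (simp add: P_def diff_diff_eq add.commute)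
      then show "(\<lambda>x. \<beta> (x + sum \<mu> A)) \<in> supp_comp S (D - int q - 1)"
        by (auto simp: supp_comp_def)
      show "\<forall>y. L y A (\<lambda>x. \<beta> (x + sum \<mu> A)) = \<beta> y" by (simp add: L_def)
    qed
    show "v \<in> V" "w \<in> V" by (fact vw)+
    show "P y A" if P: "P y B" and AB: "A \<subseteq> B" for y A B
    proof -
      have BV: "B \<subseteq> V" using P by (simp add: P_def)
      then have fin: "finite B" using finite_subset fin_V by blast
      have "S (D - int (card B) + int (card (B - A))) (y - sum \<mu> B + sum \<mu> (B - A))"
        using P fin BV by (intro S_add_sum) (auto simp: P_def)
      moreover have "sum \<mu> B = sum \<mu> (B - A) + sum \<mu> A" using sum.subset_diff[OF AB fin] .
      moreover have "int (card (B - A)) = int (card B) - int (card A)"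
        using card_Diff_subset[OF finite_subset[OF AB fin] AB] card_mono[OF fin AB] by simp
      ultimately show ?thesis using BV AB by (simp add: P_def)
    qed
    show "P y (insert v A) \<or> P y (insert w A)"
      if "A \<subseteq> V" "card A = q" "P y A" "v \<notin> A" "w \<notin> A" for y A
    proof -
      have "S (D - int q) (y - sum \<mu> A)" using that by (simp add: P_def)
      from a[OF r this] show ?thesis
        using that ins[of A] vw by (auto simp: P_def algebra_simps)
    qed
    show "P y (insert w A)"
      if A: "A \<subseteq> V" "card A = q" "P y A" "v \<in> A" "w \<notin> A" and P': "P y (insert w (A - {v}))" for y A
    proof -
      have fin: "finite A" using finite_subset[OF A(1) fin_V] .
      have sA: "sum \<mu> A = sum \<mu> (A - {v}) + \<mu> v"
        using A(4) fin by (simp add: sum.remove)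
      have cA: "card (insert w (A - {v})) = q"
        using A fin card_Suc_Diff1[OF fin A(4)] by (subst card_insert_disjoint) auto
      have "S (D - int q) (y - sum \<mu> A)" using A by (simp add: P_def)
      moreover have "S (D - int q) (y - sum \<mu> A + \<mu> v - \<mu> w)"
        using P' ins[of "A - {v}" w] A cA unfolding P_def sA by (auto simp: algebra_simps)
      ultimately have "S (D - int q - 1) (y - sum \<mu> A - \<mu> w)" using b[OF r] by blast
      then show ?thesis using A vw ins[of A w] by (auto simp: P_def algebra_simps)
    qed
  qed
qed

text \<open>A cycle of top degree is an element killed by all variables. The variable
  \<open>w\<close> has weight 0 and acts on coefficient functions as the identity, hence is a
  nonzerodivisor.\<close>

lemma supp_comp_kexact_top:
  assumes w: "w \<in> V" "\<mu> w = 0" and q: "q \<ge> card V"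
  shows "kexact V (shift_fun \<mu>) (supp_comp S :: int \<Rightarrow> (int \<Rightarrow> 'k::ab_group_add) set) q D"
  unfolding kexact_def
proof safe
  interpret graded_koszul V "shift_fun \<mu>" "supp_comp S :: int \<Rightarrow> (int \<Rightarrow> 'k) set"
    by (rule supp_comp_graded)
  fix c :: "nat set \<Rightarrow> int \<Rightarrow> 'k"
  assume c: "c \<in> kchains V (supp_comp S (D - int q)) q"
    and dc: "kbd V (shift_fun \<mu>) c = (\<lambda>_. 0)"
  have c0: "c A = 0" if "A \<noteq> V" for A
  proof (cases "A \<subseteq> V")
    case True
    then have "card A < card V" using that psubset_card_mono[OF fin_V] by blast
    then show ?thesis using kchains_0[OF c] q by simp
  next
    case False
    then show ?thesis using kchains_0[OF c] by simp
  qed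
  have "0 = kbd V (shift_fun \<mu>) c (V - {w})" using dc by simp
  also have "\<dots> = ksgn w (V - {w}) (c V)"
    using w by (simp add: kbd_def double_diff insert_absorb shift_fun_def)
  finally have "c V = 0" by (metis ksgn_eq_0_iff)
  then have "c A = 0" for A using c0 by (cases "A = V") simp_all
  then have c_eq: "c = (\<lambda>_. 0)" by (rule ext)
  have "kbd V (shift_fun \<mu>) (\<lambda>_. 0 :: int \<Rightarrow> 'k) = c"
    unfolding c_eq by (simp add: kbd_def fun_eq_iff)
  then show "\<exists>b\<in>kchains V (supp_comp S (D - int q - 1)) (Suc q). kbd V (shift_fun \<mu>) b = c"
    using G_0 by (intro bexI[of _ "\<lambda>_. 0"]) (auto simp: kchains_def)
qed

text \<open>
  The cycle is the boundary of the full simplex in the multidegree of \<open>x\<close> times the product of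
  all variables.
\<close>

lemma supp_comp_not_kexact:
  assumes w: "w \<in> V" "\<mu> w = 0" and q: "card V = Suc q" and r: "D - int q = r"
    and nS: "\<not> S (r - 1) x" and S: "\<And>k. k \<in> V \<Longrightarrow> S r (x + \<mu> k)"
  shows "\<not> kexact V (shift_fun \<mu>) (supp_comp S :: int \<Rightarrow> (int \<Rightarrow> 'k::{ab_group_add,zero_neq_one}) set) q D"
proof
  interpret graded_koszul V "shift_fun \<mu>" "supp_comp S :: int \<Rightarrow> (int \<Rightarrow> 'k) set"
    by (rule supp_comp_graded)
  assume ex: "kexact V (shift_fun \<mu>) (supp_comp S :: int \<Rightarrow> (int \<Rightarrow> 'k) set) q D"
  \<comment> \<open>The only possible filling, which is not admissible because \<open>x\<close> is
    missing in degree \<open>r - 1\<close>; its boundary is admissible.\<close>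
  define \<delta> :: "nat set \<Rightarrow> int \<Rightarrow> 'k" where "\<delta> A = (\<lambda>y. if A = V \<and> y = x then 1 else 0)" for A
  define c where "c = kbd V (shift_fun \<mu>) \<delta>"
  have cA: "c (V - {k}) = ksgn k (V - {k}) (\<lambda>y. if y = x + \<mu> k then 1 else 0)" if "k \<in> V" for k
  proof -
    have "(\<lambda>y. \<delta> V (y - \<mu> k)) = (\<lambda>y. if y = x + \<mu> k then 1 else 0)"
      by (auto simp: \<delta>_def)
    then show ?thesis using that
      by (simp add: c_def kbd_def double_diff insert_absorb shift_fun_def)
  qed
  have "c \<in> kchains V (supp_comp S (D - int q)) q"
  proof (rule kchainsI)
    fix A assume A: "A \<subseteq> V" "card A = q"
    then have "card (V - A) = 1" using q card_Diff_subset[OF finite_subset[OF A(1) fin_V] A(1)] by simp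
    then obtain k where k: "V - A = {k}" by (rule card_1_singletonE)
    then have "A = V - {k}" "k \<in> V" using A(1) by auto
    have "(\<lambda>y. if y = x + \<mu> k then 1 else 0) \<in> supp_comp S (D - int q)"
      using S[OF \<open>k \<in> V\<close>] r by (simp add: supp_comp_def)
    then show "c A \<in> supp_comp S (D - int q)"
      unfolding \<open>A = _\<close> cA[OF \<open>k \<in> V\<close>] by (rule G_ksgn)
  next
    fix A assume A: "\<not> (A \<subseteq> V \<and> card A = q)"
    show "c A = 0"
    proof (cases "A \<subseteq> V")
      case True
      have "insert k A \<noteq> V" if "k \<in> V - A" for k
        using card_insert_disjoint[of A k] finite_subset[OF True fin_V] A True q that by auto
      then have "\<delta> (insert k A) = 0" if "k \<in> V - A" for k
        using that by (simp add: \<delta>_def fun_eq_iff)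
      then show ?thesis by (simp add: c_def kbd_def)
    qed (simp add: c_def kbd_def)
  qed
  moreover have "kbd V (shift_fun \<mu>) c = (\<lambda>_. 0)" unfolding c_def by (rule kbd_kbd)
  ultimately obtain b where b: "b \<in> kchains V (supp_comp S (D - int q - 1)) (Suc q)"
    "kbd V (shift_fun \<mu>) b = c"
    using kexactD[OF ex] by blast
  have "b V \<in> supp_comp S (r - 1)" using kchains_mem'[OF b(1) G_0, of V] r by simp
  then have "b V x = 0" using nS by (auto simp: supp_comp_def)
  \<comment> \<open>Uniqueness of the filling: since \<open>w\<close> acts as the identity, its top
    coefficient can be read off the boundary at \<open>V - {w}\<close>.\<close>
  moreover have "c (V - {w}) = ksgn w (V - {w}) (b V)"
    unfolding b(2)[symmetric] using w by (simp add: kbd_def double_diff insert_absorb shift_fun_def)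
  then have "ksgn w (V - {w}) (c (V - {w})) = b V" by simp
  then have "b V = (\<lambda>y. if y = x + \<mu> w then 1 else 0)" unfolding cA[OF w(1)] by simp
  then have "b V x = 1" using w(2) by simp
  ultimately show False by simp
qed

end

section \<open>Minimal graded free resolutions\<close>

lemma sum_fun_apply: "(sum f I :: 'a \<Rightarrow> 'b::ab_group_add) x = (\<Sum>i\<in>I. f i x)"
  by (induction I rule: infinite_finite_induct) auto

lemma free_mod_0: "0 \<in> free_mod N b"
  by (simp add: free_mod_def poly_ring_def)

lemma poly_ring_add: "f \<in> poly_ring N \<Longrightarrow> g \<in> poly_ring N \<Longrightarrow> f + g \<in> poly_ring N"
  using keys_add[of f g] by (fastforce simp: poly_ring_def)

lemma free_mod_add: "x \<in> free_mod N b \<Longrightarrow> y \<in> free_mod N b \<Longrightarrow> x + y \<in> free_mod N b"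
  by (simp add: free_mod_def poly_ring_add)

lemma free_mod_sum: "(\<And>i. i \<in> I \<Longrightarrow> f i \<in> free_mod N b) \<Longrightarrow> sum f I \<in> free_mod N b"
  by (induction I rule: infinite_finite_induct) (auto simp: free_mod_0 free_mod_add)

lemma free_comp_subset: "x \<in> free_comp N b e d \<Longrightarrow> x \<in> free_mod N b"
  by (simp add: free_comp_def)

lemma Var_poly_ring: "k \<in> {1..N} \<Longrightarrow> (Var k :: 'k::comm_ring_1 mpoly) \<in> poly_ring N"
  by (auto simp: Var_def poly_ring_def keys_single)

definition homog_part :: "(nat \<Rightarrow> int) \<Rightarrow> int \<Rightarrow> (nat \<Rightarrow> 'k::comm_ring_1 mpoly) \<Rightarrow> nat \<Rightarrow> 'k mpoly" where
  "homog_part e c y = (\<lambda>j. Abs_poly_mapping (\<lambda>t. if int (mon_deg t) + e j = c then Poly_Mapping.lookup (y j) t else 0))"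

lemma lookup_homog_part:
  "Poly_Mapping.lookup (homog_part e c y j) t = (if int (mon_deg t) + e j = c then Poly_Mapping.lookup (y j) t else 0)"
proof -
  have "finite {t. (if int (mon_deg t) + e j = c then Poly_Mapping.lookup (y j) t else 0) \<noteq> 0}"
    by (rule finite_subset[OF _ finite_keys[of "y j"]]) (auto simp: in_keys_iff)
  then show ?thesis by (simp add: homog_part_def)
qed

lemma free_mod_lookup:
  assumes "x \<in> free_mod N b" "Poly_Mapping.lookup (x j) t \<noteq> 0"
  shows "j \<in> {1..b}" "Poly_Mapping.keys t \<subseteq> {1..N}"
proof -
  have "x j \<noteq> 0" using assms(2) by auto
  then show "j \<in> {1..b}" using assms(1) unfolding free_mod_def by blast
  have "t \<in> Poly_Mapping.keys (x j)" using assms(2) by (simp add: in_keys_iff)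
  then show "Poly_Mapping.keys t \<subseteq> {1..N}"
    using assms(1) unfolding free_mod_def poly_ring_def by blast
qed

lemma homog_part_free_comp: "y \<in> free_mod N b \<Longrightarrow> homog_part e c y \<in> free_comp N b e c"
  unfolding free_comp_iff lookup_homog_part using free_mod_lookup by (fastforce split: if_splits)

lemma sum_homog_part:
  assumes y: "y \<in> free_mod N b"
  obtains C where "finite C" "\<And>C'. finite C' \<Longrightarrow> C \<subseteq> C' \<Longrightarrow> y = (\<Sum>c\<in>C'. homog_part e c y)"
proof
  define C where "C = (\<Union>j\<in>{1..b}. (\<lambda>t. int (mon_deg t) + e j) ` Poly_Mapping.keys (y j))"
  show "finite C" by (simp add: C_def)
  fix C' assume C': "finite C'" "C \<subseteq> C'"
  show "y = (\<Sum>c\<in>C'. homog_part e c y)"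
  proof (intro ext poly_mapping_eqI)
    fix j t
    have "Poly_Mapping.lookup ((\<Sum>c\<in>C'. homog_part e c y) j) t =
        (if int (mon_deg t) + e j \<in> C' then Poly_Mapping.lookup (y j) t else 0)"
      unfolding sum_fun_apply lookup_sum lookup_homog_part using C'(1) by simp
    also have "\<dots> = Poly_Mapping.lookup (y j) t"
    proof (cases "Poly_Mapping.lookup (y j) t = 0")
      case False
      then have "int (mon_deg t) + e j \<in> C"
        unfolding C_def using free_mod_lookup(1)[OF y False] by (intro UN_I image_eqI) (auto simp: in_keys_iff)
      then show ?thesis using C' by auto
    qed simp
    finally show "Poly_Mapping.lookup (y j) t = Poly_Mapping.lookup ((\<Sum>c\<in>C'. homog_part e c y) j) t" ..
  qed
qed

lemma graded_hom_add:
  assumes "graded_hom N b e b' e' \<phi>" "x \<in> free_mod N b" "y \<in> free_mod N b"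
  shows "\<phi> (x + y) = \<phi> x + \<phi> y"
  using assms by (simp add: graded_hom_def plus_fun_def)

lemma graded_hom_0:
  assumes "graded_hom N b e b' e' \<phi>"
  shows "\<phi> 0 = 0"
  using graded_hom_add[OF assms free_mod_0 free_mod_0] by simp

lemma graded_hom_sum:
  assumes "graded_hom N b e b' e' \<phi>" "\<And>i. i \<in> I \<Longrightarrow> f i \<in> free_mod N b"
  shows "\<phi> (sum f I) = (\<Sum>i\<in>I. \<phi> (f i))"
  using assms(2)
  by (induction I rule: infinite_finite_induct)
    (auto simp: graded_hom_0[OF assms(1)] graded_hom_add[OF assms(1)] free_mod_sum)

lemma graded_hom_free_comp:
  assumes "graded_hom N b e b' e' \<phi>" "x \<in> free_comp N b e d"
  shows "\<phi> x \<in> free_comp N b' e' d"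
  using assms by (simp add: graded_hom_def free_comp_def)

lemma graded_hom_vec_mult:
  assumes "graded_hom N b e b' e' \<phi>" "x \<in> free_mod N b" "k \<in> {1..N}"
  shows "\<phi> (vec_mult k x) = vec_mult k (\<phi> x)"
  using assms(1,2) Var_poly_ring[OF assms(3)] unfolding graded_hom_def vec_mult_def by blast

text \<open>The components of \<open>y\<close> in the other degrees are mapped to other degrees, so
  their total image lies both in degree \<open>d\<close> and outside it. This turns exactness of the
  modules, as a resolution is defined, into exactness in each degree.\<close>

lemma graded_hom_homog_preimage:
  assumes hom: "graded_hom N b e b' e' \<phi>" and y: "y \<in> free_mod N b" and d: "\<phi> y \<in> free_comp N b' e' d"
  shows "\<phi> y = \<phi> (homog_part e d y)"
proof -
  interpret F': graded_koszul "{1..N}" vec_mult "free_comp N b' e'" by (rule free_comp_graded)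
  obtain C where C: "finite C" "\<And>C'. finite C' \<Longrightarrow> C \<subseteq> C' \<Longrightarrow> y = (\<Sum>c\<in>C'. homog_part e c y)"
    using sum_homog_part[OF y] by blast
  have "y = (\<Sum>c\<in>insert d C. homog_part e c y)"
    by (rule C(2)) (use C(1) in auto)
  then have "\<phi> y = \<phi> (\<Sum>c\<in>insert d C. homog_part e c y)" by (rule arg_cong)
  also have "\<dots> = (\<Sum>c\<in>insert d C. \<phi> (homog_part e c y))"
    by (rule graded_hom_sum[OF hom]) (rule free_comp_subset[OF homog_part_free_comp[OF y]])
  also have "\<dots> = \<phi> (homog_part e d y) + (\<Sum>c\<in>C - {d}. \<phi> (homog_part e c y))"
    using C(1) by (simp add: sum.insert_remove)
  finally have R: "(\<Sum>c\<in>C - {d}. \<phi> (homog_part e c y)) = \<phi> y - \<phi> (homog_part e d y)" (is "?R = _")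
    by simp
  have R_d: "?R \<in> free_comp N b' e' d"
    unfolding R by (intro F'.G_diff d graded_hom_free_comp[OF hom] homog_part_free_comp y)
  have "?R j = 0" for j
  proof (rule poly_mapping_eqI)
    fix t
    show "Poly_Mapping.lookup (?R j) t = Poly_Mapping.lookup 0 t"
    proof (rule ccontr)
      assume "\<not> ?thesis"
      then have nz: "Poly_Mapping.lookup (?R j) t \<noteq> 0" by simp
      then have "int (mon_deg t) = d - e' j" using R_d unfolding free_comp_iff by blast
      moreover obtain c where c: "c \<in> C - {d}" "Poly_Mapping.lookup (\<phi> (homog_part e c y) j) t \<noteq> 0"
        using nz unfolding sum_fun_apply lookup_sum by (rule sum.not_neutral_contains_not_neutral)
      have "\<phi> (homog_part e c y) \<in> free_comp N b' e' c"
        by (intro graded_hom_free_comp[OF hom] homog_part_free_comp y)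
      then have "int (mon_deg t) = c - e' j" using c(2) unfolding free_comp_iff by blast
      ultimately show False using c(1) by simp
    qed
  qed
  then have "?R = 0" by (simp add: fun_eq_iff)
  then show ?thesis using R by simp
qed

text \<open>A vector without constant terms is a combination of the variables: each monomial is
  assigned to its variable of least index, and \<open>g k\<close> collects the quotients by the
  variable \<open>k\<close>.\<close>

lemma free_comp_zero_chain_boundary:
  assumes c: "c \<in> kchains {1..N} (free_comp N b e d) 0"
    and const: "\<And>j. Poly_Mapping.lookup (c {} j) 0 = 0"
  obtains a where "a \<in> kchains {1..N} (free_comp N b e (d - 1)) (Suc 0)" "kbd {1..N} vec_mult a = c"
proof -
  let ?s = "\<lambda>k. Poly_Mapping.single k (1::nat)"
  have c0: "c {} \<in> free_comp N b e d" using kchains_mem[OF c, of "{}"] by simp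
  define g where "g k j = Abs_poly_mapping (\<lambda>s. if k = Min (Poly_Mapping.keys (s + ?s k))
    then Poly_Mapping.lookup (c {} j) (s + ?s k) else 0)" for k j
  have lookup_g: "Poly_Mapping.lookup (g k j) s = (if k = Min (Poly_Mapping.keys (s + ?s k))
    then Poly_Mapping.lookup (c {} j) (s + ?s k) else 0)" for k j s
  proof -
    have "finite ((\<lambda>s. s + ?s k) -` Poly_Mapping.keys (c {} j))"
      by (rule finite_vimageI) (auto intro: injI)
    then have "finite {s. (if k = Min (Poly_Mapping.keys (s + ?s k))
        then Poly_Mapping.lookup (c {} j) (s + ?s k) else 0) \<noteq> 0}"
      by (rule rev_finite_subset) (auto simp: in_keys_iff)
    then show ?thesis by (simp add: g_def)
  qed
  have g: "g k \<in> free_comp N b e (d - 1)" for k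
    unfolding free_comp_iff
  proof (intro allI impI)
    fix j t assume "Poly_Mapping.lookup (g k j) t \<noteq> 0"
    then have "Poly_Mapping.lookup (c {} j) (t + ?s k) \<noteq> 0"
      by (auto simp: lookup_g split: if_splits)
    then show "j \<in> {1..b} \<and> Poly_Mapping.keys t \<subseteq> {1..N} \<and> int (mon_deg t) = d - 1 - e j"
      using c0 unfolding free_comp_iff by (force simp: keys_nat_add mon_deg_add)
  qed
  define a where "a A = (if A \<subseteq> {1..N} \<and> card A = Suc 0 then g (Min A) else 0)" for A
  have a: "a \<in> kchains {1..N} (free_comp N b e (d - 1)) (Suc 0)"
    using g by (auto simp: kchains_def a_def)
  interpret F: graded_koszul "{1..N}" "vec_mult :: nat \<Rightarrow> (nat \<Rightarrow> 'a mpoly) \<Rightarrow> _" "free_comp N b e" by (rule free_comp_graded)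
  have da: "kbd {1..N} vec_mult a \<in> kchains {1..N} (free_comp N b e d) 0"
    using F.kbd_kchains[OF a] by simp
  have "kbd {1..N} vec_mult a {} = c {}"
  proof (intro ext poly_mapping_eqI)
    fix j t
    have "kbd {1..N} vec_mult a {} = (\<Sum>k\<in>{1..N}. vec_mult k (g k))"
      by (auto simp: kbd_def ksgn_def a_def intro!: sum.cong)
    then have "Poly_Mapping.lookup (kbd {1..N} vec_mult a {} j) t
        = (\<Sum>k\<in>{1..N}. Poly_Mapping.lookup (Var k * g k j) t)"
      by (simp add: sum_fun_apply lookup_sum vec_mult_def)
    \<comment> \<open>For \<open>t = 0\<close> the minimum is taken over the empty set and says
      nothing, so this case is kept apart; there the coefficient vanishes by assumption.\<close>
    also have "\<dots> = (\<Sum>k\<in>{1..N}. if k = Min (Poly_Mapping.keys t) \<and> t \<noteq> 0 then Poly_Mapping.lookup (c {} j) t else 0)"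
    proof (rule sum.cong)
      fix k
      show "Poly_Mapping.lookup (Var k * g k j) t
          = (if k = Min (Poly_Mapping.keys t) \<and> t \<noteq> 0 then Poly_Mapping.lookup (c {} j) t else 0)"
      proof (cases "k \<in> Poly_Mapping.keys t")
        case True
        then have tk: "t - ?s k + ?s k = t"
          using sqfree_mon_minus_add[of "{k}" t] by (simp add: sqfree_mon_def)
        have "t \<noteq> 0" using True by auto
        then show ?thesis using True unfolding lookup_Var_mult lookup_g tk by simp
      next
        case False
        have "Min (Poly_Mapping.keys t) \<in> Poly_Mapping.keys t" if "t \<noteq> 0"
          using that by (intro Min_in) (auto simp: poly_mapping_eq_iff fun_eq_iff in_keys_iff)
        then show ?thesis using False by (auto simp: lookup_Var_mult)
      qed
    qed simp
    also have "\<dots> = Poly_Mapping.lookup (c {} j) t"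
    proof (cases "Poly_Mapping.lookup (c {} j) t = 0")
      case False
      then have t: "t \<noteq> 0" using const by auto
      then have "Min (Poly_Mapping.keys t) \<in> Poly_Mapping.keys t"
        by (intro Min_in) (auto simp: poly_mapping_eq_iff fun_eq_iff in_keys_iff)
      moreover have "Poly_Mapping.keys t \<subseteq> {1..N}" using c0 False unfolding free_comp_iff by blast
      ultimately have "Min (Poly_Mapping.keys t) \<in> {1..N}" by blast
      then show ?thesis using t by simp
    qed (auto intro: sum.neutral)
    finally show "Poly_Mapping.lookup (kbd {1..N} vec_mult a {} j) t = Poly_Mapping.lookup (c {} j) t" .
  qed
  moreover have "kbd {1..N} vec_mult a A = c A" if "A \<noteq> {}" for A
    using kchains_0[OF c, of A] kchains_0[OF da, of A] that finite_subset[of A "{1..N}"]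
    by (cases "A \<subseteq> {1..N}") (auto simp: card_gt_0_iff)
  ultimately have "kbd {1..N} vec_mult a = c" by (metis ext)
  with a show ?thesis by (rule that)
qed

section \<open>Dimension shifting along a minimal resolution\<close>

locale resolution =
  fixes N :: nat and I :: "'k::comm_ring_1 mpoly set" and p \<beta> e
    and \<phi> :: "nat \<Rightarrow> (nat \<Rightarrow> 'k mpoly) \<Rightarrow> nat \<Rightarrow> 'k mpoly"
    and Y :: "nat \<Rightarrow> 'h::ab_group_add \<Rightarrow> 'h" and G' ev
  assumes N: "N \<ge> 1"
    and res: "is_min_graded_free_res N I p \<beta> e \<phi>"
    and aug: "koszul_ses {1..N} vec_mult (free_comp N (\<beta> 0) (e 0)) Y G' ev"
    and ker_aug: "\<And>x d. x \<in> free_comp N (\<beta> 0) (e 0) d \<Longrightarrow> ev x = 0 \<longleftrightarrow> x 1 \<in> I"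
begin

definition syz :: "nat \<Rightarrow> int \<Rightarrow> (nat \<Rightarrow> 'k mpoly) set" where
  "syz i d = {x \<in> free_comp N (\<beta> i) (e i) d. if i = 0 then ev x = 0 else \<phi> i x = 0}"

lemma hom: "i \<in> {1..p} \<Longrightarrow> graded_hom N (\<beta> i) (e i) (\<beta> (i - 1)) (e (i - 1)) (\<phi> i)"
  using res by (simp add: is_min_graded_free_res_def)

lemma syz_p: "syz p d = {0}"
proof -
  have p: "p \<ge> 1" "hom_ker N (\<beta> p) (\<phi> p) = {\<lambda>j. 0}"
    using res by (auto simp: is_min_graded_free_res_def)
  interpret F: graded_koszul "{1..N}" vec_mult "free_comp N (\<beta> p) (e p)" by (rule free_comp_graded)
  have "\<phi> p 0 = 0" using graded_hom_0[OF hom[of p]] p by simp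
  then have "0 \<in> syz p d" using F.G_0[of d] p(1) by (simp add: syz_def)
  moreover have "x = 0" if "x \<in> syz p d" for x
  proof -
    have "x \<in> hom_ker N (\<beta> p) (\<phi> p)"
      using that p(1) by (auto simp: syz_def hom_ker_def zero_fun_def dest: free_comp_subset)
    then show ?thesis using p(2) by (auto simp: zero_fun_def)
  qed
  ultimately show ?thesis by blast
qed

text \<open>At \<open>i = 1\<close> exactness is stated through the first coordinate only; this
  suffices because \<open>\<beta> 0 = 1\<close>, so the other coordinates vanish.\<close>

lemma syz_image:
  assumes i: "i \<in> {1..p}"
  shows "\<phi> i ` free_comp N (\<beta> i) (e i) d = syz (i - 1) d"
proof -
  note h = hom[OF i]
  have range: "x \<in> \<phi> i ` free_mod N (\<beta> i) \<longleftrightarrow> (if i - 1 = 0 then ev x = 0 else \<phi> (i - 1) x = 0)"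
    if x: "x \<in> free_comp N (\<beta> (i - 1)) (e (i - 1)) d" for x
  proof (cases "i = 1")
    case True
    have I: "(\<lambda>x. x 1) ` \<phi> 1 ` free_mod N (\<beta> 1) = I" and b0: "\<beta> 0 = 1"
      using res by (auto simp: is_min_graded_free_res_def)
    have "ev x = 0 \<longleftrightarrow> x 1 \<in> I" using ker_aug x True by simp
    also have "\<dots> \<longleftrightarrow> (\<exists>y\<in>free_mod N (\<beta> 1). x 1 = \<phi> 1 y 1)" unfolding I[symmetric] by auto
    also have "\<dots> \<longleftrightarrow> (\<exists>y\<in>free_mod N (\<beta> 1). x = \<phi> 1 y)"
    proof (rule bex_cong[OF refl])
      fix y :: "nat \<Rightarrow> 'k mpoly" assume "y \<in> free_mod N (\<beta> 1)"
      then have "\<phi> 1 y \<in> free_mod N 1" using h b0 True by (simp add: graded_hom_def)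
      moreover have "x \<in> free_mod N 1" using free_comp_subset[OF x] b0 True by simp
      ultimately have "x j = \<phi> 1 y j" if "j \<noteq> 1" for j
        using that by (simp add: free_mod_def)
      then show "x 1 = \<phi> 1 y 1 \<longleftrightarrow> x = \<phi> 1 y" by (metis ext)
    qed
    finally show ?thesis using True by auto
  next
    case False
    with i have "i - 1 \<in> {1..<p}" "i - 1 + 1 = i" by auto
    then have "hom_ker N (\<beta> (i - 1)) (\<phi> (i - 1)) = \<phi> i ` free_mod N (\<beta> i)"
      using res unfolding is_min_graded_free_res_def by metis
    then show ?thesis
      using False i free_comp_subset[OF x] by (auto simp: hom_ker_def zero_fun_def)
  qed
  show ?thesis
  proof
    show "\<phi> i ` free_comp N (\<beta> i) (e i) d \<subseteq> syz (i - 1) d"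
    proof
      fix x assume "x \<in> \<phi> i ` free_comp N (\<beta> i) (e i) d"
      then obtain y where y: "y \<in> free_comp N (\<beta> i) (e i) d" "x = \<phi> i y" by auto
      then have "x \<in> free_comp N (\<beta> (i - 1)) (e (i - 1)) d"
        using graded_hom_free_comp[OF h] by blast
      then show "x \<in> syz (i - 1) d"
        using range y free_comp_subset[OF y(1)] unfolding syz_def by blast
    qed
    show "syz (i - 1) d \<subseteq> \<phi> i ` free_comp N (\<beta> i) (e i) d"
    proof
      fix x assume "x \<in> syz (i - 1) d"
      then have x: "x \<in> free_comp N (\<beta> (i - 1)) (e (i - 1)) d"
        and "x \<in> \<phi> i ` free_mod N (\<beta> i)" using range by (auto simp: syz_def)
      then obtain y where y: "y \<in> free_mod N (\<beta> i)" "x = \<phi> i y" by blast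
      then show "x \<in> \<phi> i ` free_comp N (\<beta> i) (e i) d"
        using graded_hom_homog_preimage[OF h y(1), of d] homog_part_free_comp[OF y(1)] x by blast
    qed
  qed
qed

text \<open>Minimality in the form used below: the kernel of \<open>\<phi> i\<close> is the image of
  \<open>\<phi> (i + 1)\<close>, or zero at the end, and so lies in the maximal ideal times the free
  module.\<close>

lemma syz_const:
  assumes i: "i \<in> {1..p}" and x: "x \<in> syz i d"
  shows "Poly_Mapping.lookup (x j) 0 = 0"
proof (cases "i = p")
  case True
  then show ?thesis using syz_p x by auto
next
  case False
  then have i': "i + 1 \<in> {1..p}" using i by auto
  obtain y where "y \<in> free_comp N (\<beta> (i + 1)) (e (i + 1)) d" "x = \<phi> (i + 1) y"
    using syz_image[OF i', of d] x by auto
  then show ?thesis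
    using res i' free_comp_subset unfolding is_min_graded_free_res_def by blast
qed

lemma ses:
  assumes "i \<in> {1..p}"
  shows "koszul_ses {1..N} vec_mult (free_comp N (\<beta> i) (e i)) vec_mult (syz (i - 1)) (\<phi> i)"
  using assms
proof (induction i)
  case (Suc i)
  have graded: "graded_koszul {1..N} vec_mult (syz i)"
  proof (cases "i = 0")
    case True
    interpret A: koszul_ses "{1..N}" vec_mult "free_comp N (\<beta> 0) (e 0)" Y G' ev by (rule aug)
    have "syz i = A.Z" using True by (auto simp: syz_def fun_eq_iff)
    then show ?thesis using A.Z.graded_koszul_axioms by simp
  next
    case False
    interpret A: koszul_ses "{1..N}" vec_mult "free_comp N (\<beta> i) (e i)" vec_mult "syz (i - 1)" "\<phi> i"
      using Suc False by auto
    have "syz i = A.Z" using False by (auto simp: syz_def fun_eq_iff)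
    then show ?thesis using A.Z.graded_koszul_axioms by simp
  qed
  note h = hom[OF Suc.prems]
  interpret F: graded_koszul "{1..N}" vec_mult "free_comp N (\<beta> (Suc i)) (e (Suc i))" by (rule free_comp_graded)
  interpret G: graded_koszul "{1..N}" vec_mult "syz i" by (rule graded)
  show ?case
  proof
    show "\<phi> (Suc i) (x + y) = \<phi> (Suc i) x + \<phi> (Suc i) y"
      if "x \<in> free_comp N (\<beta> (Suc i)) (e (Suc i)) d" "y \<in> free_comp N (\<beta> (Suc i)) (e (Suc i)) d" for x y d
      using that graded_hom_add[OF h] free_comp_subset by blast
    show "\<phi> (Suc i) (vec_mult k x) = vec_mult k (\<phi> (Suc i) x)"
      if "k \<in> {1..N}" "x \<in> free_comp N (\<beta> (Suc i)) (e (Suc i)) d" for k x d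
      using that graded_hom_vec_mult[OF h] free_comp_subset by blast
  qed (use graded syz_image[OF Suc.prems] in \<open>simp_all add: graded_koszul.G_0 graded_koszul.G_diff graded_koszul.G_X\<close>)
qed simp

text \<open>Free modules are acyclic in positive degrees, so the long exact sequence moves the
  question one syzygy further. For \<open>q = 0\<close> acyclicity fails, and
  \<open>syz_const\<close> provides the zero map needed by \<open>kexact_step2\<close>.\<close>

lemma kexact_syz_Suc:
  assumes i: "i \<in> {1..p}"
  shows "kexact {1..N} vec_mult (syz (i - 1)) (Suc q) D \<longleftrightarrow> kexact {1..N} vec_mult (syz i) q D"
proof -
  interpret koszul_ses "{1..N}" vec_mult "free_comp N (\<beta> i) (e i)" vec_mult "syz (i - 1)" "\<phi> i"
    using ses[OF i] .
  have Z: "Z = syz i" using i by (auto simp: syz_def fun_eq_iff)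
  have "kexact {1..N} vec_mult Z q D" if "kexact {1..N} vec_mult (syz (i - 1)) (Suc q) D"
  proof (rule kexact_step2[OF _ that])
    fix z assume z: "z \<in> kchains {1..N} (Z (D - int q)) q" and dz: "kbd {1..N} vec_mult z = (\<lambda>_. 0)"
    then have zF: "z \<in> kchains {1..N} (free_comp N (\<beta> i) (e i) (D - int q)) q"
      by (auto simp: kchains_def)
    show "\<exists>a\<in>kchains {1..N} (free_comp N (\<beta> i) (e i) (D - int q - 1)) (Suc q). kbd {1..N} vec_mult a = z"
    proof (cases "q = 0")
      case True
      have "z {} \<in> syz i D" using kchains_mem[OF z, of "{}"] True i by (simp add: syz_def)
      then show ?thesis
        using free_comp_zero_chain_boundary[of z N "\<beta> i" "e i" D] zF syz_const[OF i] True by auto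
    next
      case False
      then have "q \<ge> 1" by simp
      show ?thesis by (rule kexactD[OF free_comp_kexact[OF N \<open>q \<ge> 1\<close>] zF dz]) blast
    qed
  qed
  moreover have "kexact {1..N} vec_mult (syz (i - 1)) (Suc q) D" if "kexact {1..N} vec_mult Z q D"
    by (rule kexact_step1[OF free_comp_kexact[OF N] that]) simp
  ultimately show ?thesis unfolding Z by blast
qed

lemma kexact_aug_Suc:
  "kexact {1..N} Y G' (Suc q) D \<longleftrightarrow> kexact {1..N} vec_mult (syz 0) q D"
proof -
  interpret koszul_ses "{1..N}" vec_mult "free_comp N (\<beta> 0) (e 0)" Y G' ev by (rule aug)
  have Z: "Z = syz 0" by (auto simp: syz_def fun_eq_iff)
  have p: "1 \<in> {1..p}" using res by (simp add: is_min_graded_free_res_def)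
  have const: "Poly_Mapping.lookup (x j) 0 = 0" if x: "x \<in> syz 0 d" for x j d
  proof -
    obtain y where "y \<in> free_comp N (\<beta> 1) (e 1) d" "x = \<phi> 1 y"
      using syz_image[OF p, of d] x by auto
    then show ?thesis
      using res p free_comp_subset unfolding is_min_graded_free_res_def by blast
  qed
  have "kexact {1..N} vec_mult Z q D" if "kexact {1..N} Y G' (Suc q) D"
  proof (rule kexact_step2[OF _ that])
    fix z assume z: "z \<in> kchains {1..N} (Z (D - int q)) q" and dz: "kbd {1..N} vec_mult z = (\<lambda>_. 0)"
    then have zF: "z \<in> kchains {1..N} (free_comp N (\<beta> 0) (e 0) (D - int q)) q"
      by (auto simp: kchains_def)
    show "\<exists>a\<in>kchains {1..N} (free_comp N (\<beta> 0) (e 0) (D - int q - 1)) (Suc q). kbd {1..N} vec_mult a = z"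
    proof (cases "q = 0")
      case True
      have "z {} \<in> syz 0 D" using kchains_mem[OF z, of "{}"] True by (simp add: syz_def)
      then show ?thesis
        using free_comp_zero_chain_boundary[of z N "\<beta> 0" "e 0" D] zF const True by auto
    next
      case False
      then have "q \<ge> 1" by simp
      show ?thesis by (rule kexactD[OF free_comp_kexact[OF N \<open>q \<ge> 1\<close>] zF dz]) blast
    qed
  qed
  moreover have "kexact {1..N} Y G' (Suc q) D" if "kexact {1..N} vec_mult Z q D"
    by (rule kexact_step1[OF free_comp_kexact[OF N] that]) simp
  ultimately show ?thesis unfolding Z by blast
qed

lemma kexact_aug_syz:
  "i \<le> p \<Longrightarrow> kexact {1..N} Y G' (q + Suc i) D \<longleftrightarrow> kexact {1..N} vec_mult (syz i) q D"
proof (induction i arbitrary: q)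
  case 0
  then show ?case using kexact_aug_Suc by simp
next
  case (Suc i)
  have "kexact {1..N} Y G' (q + Suc (Suc i)) D \<longleftrightarrow> kexact {1..N} vec_mult (syz i) (Suc q) D"
    using Suc.IH[of "Suc q"] Suc.prems by simp
  also have "\<dots> \<longleftrightarrow> kexact {1..N} vec_mult (syz (Suc i)) q D"
    using kexact_syz_Suc[of "Suc i"] Suc.prems by simp
  finally show ?case .
qed

text \<open>Exactness at 0 means that a syzygy module has no minimal generator in degree
  \<open>D\<close>. If the image of a unit vector \<open>u\<close> were a combination of syzygies
  with variables as coefficients, lifting it to \<open>x\<close> would give a kernel element
  \<open>u - x\<close> with constant term 1, against minimality. Conversely, without a shift
  \<open>D\<close> every vector of degree \<open>D\<close> has no constant terms.\<close>

lemma kexact_syz_0: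
  assumes i: "i \<in> {1..p}"
  shows "kexact {1..N} vec_mult (syz (i - 1)) 0 D \<longleftrightarrow> (\<forall>j\<in>{1..\<beta> i}. e i j \<noteq> D)"
proof -
  interpret koszul_ses "{1..N}" vec_mult "free_comp N (\<beta> i) (e i)" vec_mult "syz (i - 1)" "\<phi> i"
    using ses[OF i] .
  show ?thesis
  proof
    assume ex: "kexact {1..N} vec_mult (syz (i - 1)) 0 D"
    show "\<forall>j\<in>{1..\<beta> i}. e i j \<noteq> D"
    proof safe
      fix j assume j: "j \<in> {1..\<beta> i}" "D = e i j"
      define u :: "nat \<Rightarrow> 'k mpoly" where "u = (\<lambda>l. if l = j then 1 else 0)"
      have u: "u \<in> free_comp N (\<beta> i) (e i) D"
        using j by (auto simp: free_comp_iff u_def lookup_one when_def)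
      define c where "c A = (if A = {} then \<phi> i u else 0)" for A :: "nat set"
      have c: "c \<in> kchains {1..N} (syz (i - 1) (D - int 0)) 0"
        using u syz_image[OF i, of D] finite_subset[of _ "{1..N}"] by (auto simp: kchains_def c_def)
      obtain b where b: "b \<in> kchains {1..N} (syz (i - 1) (D - int 0 - 1)) (Suc 0)"
          "kbd {1..N} vec_mult b = c"
        using kexactD[OF ex c Z'.kbd_0_chain[OF c]] by blast
      obtain a where a: "a \<in> kchains {1..N} (free_comp N (\<beta> i) (e i) (D - int 0 - 1)) (Suc 0)"
          "\<And>A. \<phi> i (a A) = b A"
        using lift_kchains[OF b(1)] by blast
      define x where "x = kbd {1..N} vec_mult a {}"
      have "\<phi> i x = \<phi> i u"
        using fun_cong[OF kbd_map[OF a(1)], of "{}"] a(2) b(2) by (simp add: x_def c_def)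
      moreover have x: "x \<in> free_comp N (\<beta> i) (e i) D"
        using kchains_mem[OF F.kbd_kchains[OF a(1)], of "{}"] by (simp add: x_def)
      ultimately have "u - x \<in> syz i D"
        using i f_diff[OF u x] F.G_diff[OF u x] by (simp add: syz_def)
      then have "Poly_Mapping.lookup ((u - x) j) 0 = 0" using syz_const[OF i] by blast
      moreover have "Poly_Mapping.lookup (x j) 0 = 0"
        by (auto simp: x_def kbd_def ksgn_def sum_fun_apply lookup_sum vec_mult_def lookup_Var_mult intro!: sum.neutral)
      ultimately show False by (simp add: u_def lookup_minus lookup_one)
    qed
  next
    assume ne: "\<forall>j\<in>{1..\<beta> i}. e i j \<noteq> D"
    show "kexact {1..N} vec_mult (syz (i - 1)) 0 D"
      unfolding kexact_def
    proof safe
      fix c assume c: "c \<in> kchains {1..N} (syz (i - 1) (D - int 0)) 0"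
      obtain y where y: "y \<in> kchains {1..N} (free_comp N (\<beta> i) (e i) (D - int 0)) 0" "\<And>A. \<phi> i (y A) = c A"
        using lift_kchains[OF c] by blast
      have yF: "y {} \<in> free_comp N (\<beta> i) (e i) D" using kchains_mem[OF y(1), of "{}"] by simp
      have const: "Poly_Mapping.lookup (y {} j) 0 = 0" for j
      proof (rule ccontr)
        assume "\<not> ?thesis"
        then have "j \<in> {1..\<beta> i} \<and> int (mon_deg 0) = D - e i j"
          using yF unfolding free_comp_iff by blast
        then show False using ne by auto
      qed
      obtain a where a: "a \<in> kchains {1..N} (free_comp N (\<beta> i) (e i) (D - int 0 - 1)) (Suc 0)"
          "kbd {1..N} vec_mult a = y"
        using free_comp_zero_chain_boundary[OF y(1) const] by blast
      have "kbd {1..N} vec_mult (\<lambda>A. \<phi> i (a A)) = c"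
        using kbd_map[OF a(1)] a(2) y(2) by auto
      with map_kchains[OF a(1)]
      show "\<exists>b\<in>kchains {1..N} (syz (i - 1) (D - int 0 - 1)) (Suc 0). kbd {1..N} vec_mult b = c" by blast
    qed
  qed
qed

text \<open>The left side does not mention the resolution, so the sets of shifts are invariants of
  the module.\<close>

lemma kexact_iff_no_shift:
  assumes i: "i \<in> {1..p}"
  shows "kexact {1..N} Y G' i D \<longleftrightarrow> (\<forall>j\<in>{1..\<beta> i}. e i j \<noteq> D)"
proof -
  have "i - 1 \<le> p" "0 + Suc (i - 1) = i" using i by auto
  then show ?thesis using kexact_aug_syz[of "i - 1" 0 D] kexact_syz_0[OF i] by simp
qed

lemma kexact_above:
  assumes i: "i > p"
  shows "kexact {1..N} Y G' i D"
proof -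
  have "kexact {1..N} vec_mult (syz p) (i - Suc p) D"
    unfolding kexact_def
  proof safe
    fix c :: "nat set \<Rightarrow> nat \<Rightarrow> 'k mpoly"
    assume c: "c \<in> kchains {1..N} (syz p (D - int (i - Suc p))) (i - Suc p)" and dc: "kbd {1..N} vec_mult c = (\<lambda>_. 0)"
    have "c = (\<lambda>_. 0)" using kchains_mem'[OF c] by (auto simp: syz_p)
    with dc have "kbd {1..N} vec_mult (\<lambda>_. 0) = c" by simp
    then show "\<exists>b\<in>kchains {1..N} (syz p (D - int (i - Suc p) - 1)) (Suc (i - Suc p)). kbd {1..N} vec_mult b = c"
      by (intro bexI[of _ "\<lambda>_. 0"]) (auto simp: kchains_def syz_p)
  qed
  then show ?thesis using kexact_aug_syz[of p "i - Suc p" D] i by simp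
qed

end

section \<open>The semigroup of an arithmetic sequence\<close>

text \<open>
  Here \<open>a\<close> is \<open>m 1\<close>, \<open>d\<close> is the common difference divided by \<open>h\<close>, and \<open>N\<close> is \<open>n - 1\<close>. A sum of
  \<open>\<rho>\<close> copies of \<open>m 1\<close> and of generators \<open>m i = h * (a + (i - 1) * d)\<close> is written as
  \<open>\<rho> * a + h * (q * a + d * \<sigma>)\<close> with \<open>\<rho> < h\<close>, where \<open>h\<close> copies of \<open>m 1\<close> are absorbed into \<open>q\<close>.
  The least number of generators needed for given \<open>\<rho>\<close>, \<open>q\<close>, \<open>\<sigma>\<close> is the larger of the two bounds in
  \<open>S\<close>: the second one is larger iff \<open>q > \<sigma>\<close>, when at most \<open>\<sigma>\<close> of the generators other than \<open>m 1\<close> can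
  be used.
\<close>

locale divisible_arith_seq =
  fixes a d h N :: int
  assumes a: "a \<ge> 1" and d: "d \<ge> 1" and h: "h \<ge> 2" and N: "N \<ge> 2"
    and coprime_ah: "coprime a h" and coprime_ad: "coprime a d"
begin

definition val :: "int \<Rightarrow> int \<Rightarrow> int \<Rightarrow> int" where
  "val \<rho> q \<sigma> = \<rho> * a + h * (q * a + d * \<sigma>)"

definition S :: "int \<Rightarrow> int \<Rightarrow> bool" where
  "S \<delta> x \<longleftrightarrow> (\<exists>\<rho> q \<sigma>. 0 \<le> \<rho> \<and> \<rho> < h \<and> 0 \<le> q \<and> 0 \<le> \<sigma> \<and> \<sigma> \<le> N * q \<and> x = val \<rho> q \<sigma> \<and>
     \<rho> + q \<le> \<delta> \<and> \<rho> + h * q - (h - 1) * \<sigma> \<le> \<delta>)"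

text \<open>Replacing \<open>(q, \<sigma>)\<close> by \<open>(q - d, \<sigma> + a)\<close> preserves
  the value and lowers \<open>N * q - \<sigma>\<close> by \<open>a + N * d\<close>. The last bound
  selects the representative to which this move no longer applies.\<close>

definition canonical :: "int \<Rightarrow> int \<Rightarrow> bool" where
  "canonical q \<sigma> \<longleftrightarrow> 0 \<le> q \<and> 0 \<le> \<sigma> \<and> \<sigma> \<le> N * q \<and> N * q - \<sigma> < a + N * d"

lemma S_I:
  "0 \<le> \<rho> \<Longrightarrow> \<rho> < h \<Longrightarrow> 0 \<le> q \<Longrightarrow> 0 \<le> \<sigma> \<Longrightarrow> \<sigma> \<le> N * q \<Longrightarrow> x = val \<rho> q \<sigma> \<Longrightarrow>
     \<rho> + q \<le> \<delta> \<Longrightarrow> \<rho> + h * q - (h - 1) * \<sigma> \<le> \<delta> \<Longrightarrow> S \<delta> x"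
  unfolding S_def by blast

lemma shift_admissible:
  assumes "0 \<le> q" "0 \<le> \<sigma>" "\<sigma> \<le> N * q" "\<not> canonical q \<sigma>"
  shows "0 \<le> q - d" "0 \<le> \<sigma> + a" "\<sigma> + a \<le> N * (q - d)"
    "val \<rho> (q - d) (\<sigma> + a) = val \<rho> q \<sigma>"
    "h * (q - d) - (h - 1) * (\<sigma> + a) = h * q - (h - 1) * \<sigma> - h * d - (h - 1) * a"
proof -
  have "a + N * d \<le> N * q - \<sigma>" using assms by (auto simp: canonical_def)
  then show *: "\<sigma> + a \<le> N * (q - d)" by (simp add: algebra_simps)
  show "0 \<le> \<sigma> + a" using assms a by simp
  with * have "0 \<le> N * (q - d)" by simp
  then show "0 \<le> q - d" using N by (simp add: zero_le_mult_iff)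
  show "val \<rho> (q - d) (\<sigma> + a) = val \<rho> q \<sigma>"
    "h * (q - d) - (h - 1) * (\<sigma> + a) = h * q - (h - 1) * \<sigma> - h * d - (h - 1) * a"
    by (simp_all add: val_def algebra_simps)
qed

lemma canonical_exists:
  assumes "0 \<le> q" "0 \<le> \<sigma>" "\<sigma> \<le> N * q"
  shows "\<exists>q' \<sigma>'. canonical q' \<sigma>' \<and> val \<rho> q' \<sigma>' = val \<rho> q \<sigma> \<and> q' \<le> q \<and> \<sigma> \<le> \<sigma>'"
  using assms
proof (induction "nat q" arbitrary: q \<sigma> rule: less_induct)
  case less
  show ?case
  proof (cases "canonical q \<sigma>")
    case False
    note s = shift_admissible[OF less.prems False]
    have "nat (q - d) < nat q" using s(1) d by simp
    from less.hyps[OF this s(1-3)] show ?thesis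
      using s(4)[of \<rho>] a d by (smt (verit))
  qed auto
qed

text \<open>Reduction modulo \<open>h\<close> determines \<open>\<rho>\<close>, since
  \<open>a\<close> and \<open>h\<close> are coprime; reduction modulo \<open>d\<close> then shows
  that the two pairs differ by \<open>j\<close> moves. Both values of
  \<open>N * q - \<sigma>\<close> lie in an interval of length \<open>a + N * d\<close>, so
  \<open>j = 0\<close>.\<close>

lemma canonical_unique:
  assumes "canonical q \<sigma>" "canonical q' \<sigma>'" "0 \<le> \<rho>" "\<rho> < h" "0 \<le> \<rho>'" "\<rho>' < h"
    and eq: "val \<rho> q \<sigma> = val \<rho>' q' \<sigma>'"
  shows "\<rho> = \<rho>'" "q = q'" "\<sigma> = \<sigma>'"
proof -
  have "(\<rho> - \<rho>') * a = h * ((q' * a + d * \<sigma>') - (q * a + d * \<sigma>))"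
    using eq by (simp add: val_def algebra_simps)
  then have "h dvd (\<rho> - \<rho>') * a" by simp
  then have "h dvd \<rho> - \<rho>'" using coprime_ah by (simp add: coprime_commute coprime_dvd_mult_left_iff)
  moreover have "\<bar>\<rho> - \<rho>'\<bar> < h" using assms by linarith
  ultimately show \<rho>: "\<rho> = \<rho>'" using dvd_imp_le_int[of "\<rho> - \<rho>'" h] h by (cases "\<rho> = \<rho>'") auto
  have "q * a + d * \<sigma> = q' * a + d * \<sigma>'"
    using eq h unfolding \<rho> val_def by simp
  then have e: "(q - q') * a = d * (\<sigma>' - \<sigma>)" by (simp add: algebra_simps)
  then have "d dvd (q - q') * a" by simp
  then have "d dvd q - q'" using coprime_ad by (simp add: coprime_commute coprime_dvd_mult_left_iff)
  then obtain j where j: "q - q' = d * j" by (elim dvdE)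
  then have "d * (j * a) = d * (\<sigma>' - \<sigma>)" using e by (simp add: algebra_simps)
  then have j': "\<sigma>' - \<sigma> = j * a" using d by simp
  have "(N * q - \<sigma>) - (N * q' - \<sigma>') = N * (q - q') + (\<sigma>' - \<sigma>)" by (simp add: algebra_simps)
  also have "\<dots> = (a + N * d) * j" unfolding j j' by (simp add: algebra_simps)
  finally have k: "(N * q - \<sigma>) - (N * q' - \<sigma>') = (a + N * d) * j" .
  then have "\<bar>(a + N * d) * j\<bar> < a + N * d"
    using assms(1,2) unfolding canonical_def by linarith
  moreover have pos: "a + N * d > 0" using a N d by (simp add: add_pos_nonneg)
  ultimately have "(a + N * d) * \<bar>j\<bar> < (a + N * d) * 1" by (simp add: abs_mult)
  then have "\<bar>j\<bar> < 1" using pos by (subst (asm) mult_less_cancel_left_pos) auto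
  then have "j = 0" by simp
  then show "q = q'" "\<sigma> = \<sigma>'" using j j' by auto
qed

lemma S_canonicalE:
  assumes "S \<delta> x"
  obtains \<rho> q \<sigma> where "0 \<le> \<rho>" "\<rho> < h" "canonical q \<sigma>" "x = val \<rho> q \<sigma>"
    "\<rho> + q \<le> \<delta>" "\<rho> + h * q - (h - 1) * \<sigma> \<le> \<delta>"
proof -
  obtain \<rho> q \<sigma> where *: "0 \<le> \<rho>" "\<rho> < h" "0 \<le> q" "0 \<le> \<sigma>" "\<sigma> \<le> N * q" "x = val \<rho> q \<sigma>"
    "\<rho> + q \<le> \<delta>" "\<rho> + h * q - (h - 1) * \<sigma> \<le> \<delta>"
    using assms unfolding S_def by blast
  obtain q' \<sigma>' where c: "canonical q' \<sigma>'" "val \<rho> q' \<sigma>' = val \<rho> q \<sigma>" "q' \<le> q" "\<sigma> \<le> \<sigma>'"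
    using canonical_exists[OF *(3-5), of \<rho>] by blast
  have "h * q' \<le> h * q" "(h - 1) * \<sigma> \<le> (h - 1) * \<sigma>'"
    using c h by (simp_all add: mult_left_mono)
  then have "\<rho> + h * q' - (h - 1) * \<sigma>' \<le> \<delta>" using *(8) by linarith
  then show thesis using * c by (intro that[of \<rho> q' \<sigma>']) auto
qed

text \<open>Among all representations of an element the canonical one has the least \<open>q\<close>
  and the largest \<open>\<sigma>\<close>, hence minimizes both bounds at once.\<close>

lemma S_val_iff:
  assumes "0 \<le> \<rho>" "\<rho> < h" "canonical q \<sigma>"
  shows "S \<delta> (val \<rho> q \<sigma>) \<longleftrightarrow> \<rho> + q \<le> \<delta> \<and> \<rho> + h * q - (h - 1) * \<sigma> \<le> \<delta>"
proof
  assume "S \<delta> (val \<rho> q \<sigma>)"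
  then show "\<rho> + q \<le> \<delta> \<and> \<rho> + h * q - (h - 1) * \<sigma> \<le> \<delta>"
  proof (rule S_canonicalE)
    fix \<rho>' q' \<sigma>'
    assume *: "0 \<le> \<rho>'" "\<rho>' < h" "canonical q' \<sigma>'" "val \<rho> q \<sigma> = val \<rho>' q' \<sigma>'"
      "\<rho>' + q' \<le> \<delta>" "\<rho>' + h * q' - (h - 1) * \<sigma>' \<le> \<delta>"
    from canonical_unique[OF assms(3) *(3) assms(1,2) *(1,2) *(4)] *(5,6) show ?thesis by simp
  qed
next
  assume "\<rho> + q \<le> \<delta> \<and> \<rho> + h * q - (h - 1) * \<sigma> \<le> \<delta>"
  then show "S \<delta> (val \<rho> q \<sigma>)" using assms by (intro S_I[of \<rho> q \<sigma>]) (auto simp: canonical_def)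
qed

text \<open>
  If \<open>q > \<sigma>\<close>, adding \<open>k\<close> copies of \<open>m n\<close> turns \<open>q\<close>, \<open>\<sigma>\<close> into \<open>q + k\<close>, \<open>\<sigma> + k * N\<close> and, for large \<open>k\<close>,
  raises the degree by less than \<open>k\<close>; such elements witness that the semigroup ring is not
  Cohen-Macaulay.
\<close>

definition torsion_degs :: "int set" where
  "torsion_degs = {\<rho> + h * q - (h - 1) * \<sigma> | \<rho> q \<sigma>. 0 \<le> \<rho> \<and> \<rho> < h \<and> canonical q \<sigma> \<and> \<sigma> < q}"

definition r :: int where "r = Max torsion_degs"

lemma finite_torsion_degs: "finite torsion_degs"
proof -
  let ?B = "{0..a + N * d}"
  have "torsion_degs \<subseteq> (\<lambda>(\<rho>, q, \<sigma>). \<rho> + h * q - (h - 1) * \<sigma>) ` ({0..h} \<times> ?B \<times> ?B)"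
  proof
    fix x assume "x \<in> torsion_degs"
    then obtain \<rho> q \<sigma> where *: "x = \<rho> + h * q - (h - 1) * \<sigma>" "0 \<le> \<rho>" "\<rho> < h" "canonical q \<sigma>" "\<sigma> < q"
      by (auto simp: torsion_degs_def)
    \<comment> \<open>With \<open>\<sigma> < q\<close> and \<open>N \<ge> 2\<close>, that is
      \<open>n \<ge> 3\<close>, the quantity bounded in \<open>canonical\<close> is larger than
      \<open>q\<close>.\<close>
    have "1 * q \<le> (N - 1) * q" using N * by (intro mult_right_mono) (auto simp: canonical_def)
    also have "\<dots> = N * q - q" by (simp add: algebra_simps)
    also have "\<dots> < N * q - \<sigma>" using * by simp
    also have "\<dots> < a + N * d" using * by (simp add: canonical_def)
    finally have "q < a + N * d" by simp
    then show "x \<in> (\<lambda>(\<rho>, q, \<sigma>). \<rho> + h * q - (h - 1) * \<sigma>) ` ({0..h} \<times> ?B \<times> ?B)"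
      using * by (intro image_eqI[of _ _ "(\<rho>, q, \<sigma>)"]) (auto simp: canonical_def)
  qed
  then show ?thesis by (rule finite_subset) auto
qed

lemma r_ge:
  assumes "0 \<le> \<rho>" "\<rho> < h" "canonical q \<sigma>" "\<sigma> < q"
  shows "\<rho> + h * q - (h - 1) * \<sigma> \<le> r"
  unfolding r_def using assms by (intro Max_ge finite_torsion_degs) (auto simp: torsion_degs_def)

text \<open>With a remainder \<open>\<rho>\<close> this pair represents
  \<open>(\<rho> + h) * a\<close>. It shows that \<open>torsion_degs\<close> is nonempty and that
  \<open>r\<close> is at least \<open>\<rho> + h\<close> whenever
  \<open>0 \<le> \<rho> < h\<close>.\<close>

lemma canonical_1_0: "canonical 1 0"
proof -
  have "N * 1 \<le> N * d" using N d by (intro mult_left_mono) auto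
  then have "N * 1 - 0 < a + N * d" using a by linarith
  then show ?thesis using N by (simp add: canonical_def)
qed

lemma r_attained:
  obtains \<rho> q \<sigma> where "0 \<le> \<rho>" "\<rho> < h" "canonical q \<sigma>" "\<sigma> < q" "r = \<rho> + h * q - (h - 1) * \<sigma>"
proof -
  have "0 + h * 1 - (h - 1) * 0 \<in> torsion_degs"
    unfolding torsion_degs_def using canonical_1_0 h
    by (intro CollectI exI[of _ 0] exI[of _ 1]) simp
  then have "r \<in> torsion_degs"
    unfolding r_def by (intro Max_in finite_torsion_degs) auto
  then show thesis unfolding torsion_degs_def using that by blast
qed

text \<open>The first cone condition. If the weight 0 variable cannot be removed,
  \<open>\<delta>\<close> is the least degree of \<open>x\<close>, and \<open>\<delta> > r\<close>
  excludes \<open>\<sigma> < q\<close>. Removing the last generator changes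
  \<open>(q, \<sigma>)\<close> to \<open>(q - 1, \<sigma> - N)\<close>, which lowers the degree
  provided \<open>\<sigma> - N \<ge> q - 1\<close>.\<close>

lemma S_diff_last:
  assumes \<delta>: "\<delta> > r" and S: "S \<delta> x"
  shows "S (\<delta> - 1) (x - h * (a + N * d)) \<or> S (\<delta> - 1) x"
proof (rule ccontr)
  assume neg: "\<not> ?thesis"
  obtain \<rho> q \<sigma> where *: "0 \<le> \<rho>" "\<rho> < h" "canonical q \<sigma>" and x: "x = val \<rho> q \<sigma>"
    and cost: "\<rho> + q \<le> \<delta>" "\<rho> + h * q - (h - 1) * \<sigma> \<le> \<delta>"
    using S_canonicalE[OF S] by metis
  have can: "0 \<le> q" "0 \<le> \<sigma>" "\<sigma> \<le> N * q" "N * q - \<sigma> < a + N * d"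
    using *(3) by (auto simp: canonical_def)
  have last: "\<delta> - 1 < \<rho> + q \<or> \<delta> - 1 < \<rho> + h * q - (h - 1) * \<sigma>"
    using neg S_val_iff[OF *] unfolding x by auto
  have "q \<le> \<sigma>"
  proof (rule ccontr)
    assume "\<not> q \<le> \<sigma>"
    then have *: "\<rho> + h * q - (h - 1) * \<sigma> \<le> r" "(h - 1) * (\<sigma> + 1) \<le> (h - 1) * q"
      using r_ge[OF *] h by (auto intro: mult_left_mono)
    then have "\<rho> + q + (h - 1) \<le> r" by (simp add: algebra_simps)
    then show False using last *(1) \<delta> h by linarith
  qed
  then have "(h - 1) * q \<le> (h - 1) * \<sigma>" using h by (simp add: mult_left_mono)
  then have "\<rho> + h * q - (h - 1) * \<sigma> \<le> \<rho> + q" by (simp add: algebra_simps)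
  then have deg: "\<delta> = \<rho> + q" using last cost by linarith
  have h_le: "\<rho> + 1 \<le> r"
    using r_ge[OF *(1,2) canonical_1_0] h by simp
  have q: "q \<ge> 1"
    using deg \<delta> h_le can by linarith
  have "\<sigma> < q + N - 1"
  proof (rule ccontr)
    assume "\<not> ?thesis"
    then have \<sigma>: "\<sigma> - N \<ge> q - 1" by simp
    have "(h - 1) * (q - 1) \<le> (h - 1) * (\<sigma> - N)" using \<sigma> h by (simp add: mult_left_mono)
    then have "\<rho> + h * (q - 1) - (h - 1) * (\<sigma> - N) \<le> \<delta> - 1"
      unfolding deg by (simp add: algebra_simps)
    moreover have "x - h * (a + N * d) = val \<rho> (q - 1) (\<sigma> - N)"
      unfolding x val_def by (simp add: algebra_simps)
    moreover have "\<sigma> - N \<le> N * (q - 1)" using can by (simp add: algebra_simps)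
    ultimately have "S (\<delta> - 1) (x - h * (a + N * d))"
      using * deg q \<sigma> by (intro S_I[of \<rho> "q - 1" "\<sigma> - N"]) auto
    then show False using neg by simp
  qed
  show False
  proof (cases "q = 1")
    case True
    then show False using h_le deg \<delta> by simp
  next
    case False
    then have q2: "q \<ge> 2" using q by simp
    have "q - 2 \<le> 2 * (q - 1)" using q by simp
    also have "\<dots> \<le> N * (q - 1)" using N q by (intro mult_right_mono) auto
    finally have "q - 2 \<le> N * (q - 1)" .
    moreover have "N * (q - 1) - (q - 2) < a + N * d"
      using can \<open>\<sigma> < q + N - 1\<close> by (simp add: algebra_simps)
    \<comment> \<open>The smallest gap \<open>q > \<sigma>\<close> just below \<open>q\<close>; its
      second bound is \<open>\<delta> + h - 2\<close>, so \<open>r \<ge> \<delta>\<close>.\<close>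
    ultimately have "canonical (q - 1) (q - 2)"
      using q2 by (simp add: canonical_def)
    then have "\<rho> + h * (q - 1) - (h - 1) * (q - 2) \<le> r" using r_ge[OF *(1,2)] by simp
    then show False using deg \<delta> h by (simp add: algebra_simps)
  qed
qed

text \<open>The second cone condition. Adding the last generator preserves canonical form and raises
  the first bound by 1. So if the degree does not grow although \<open>\<delta>\<close> is least for
  \<open>x\<close>, the second bound must dominate; then \<open>\<sigma> < q\<close> and
  \<open>\<delta> \<le> r\<close>.\<close>

lemma S_cancel_last:
  assumes \<delta>: "\<delta> > r" and S: "S \<delta> x" and S': "S \<delta> (x + h * (a + N * d))"
  shows "S (\<delta> - 1) x"
proof (rule ccontr)
  assume neg: "\<not> ?thesis"
  obtain \<rho> q \<sigma> where *: "0 \<le> \<rho>" "\<rho> < h" "canonical q \<sigma>" and x: "x = val \<rho> q \<sigma>"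
    and cost: "\<rho> + q \<le> \<delta>" "\<rho> + h * q - (h - 1) * \<sigma> \<le> \<delta>"
    using S_canonicalE[OF S] by metis
  have can: "0 \<le> q" "0 \<le> \<sigma>" "\<sigma> \<le> N * q" "N * q - \<sigma> < a + N * d"
    using *(3) by (auto simp: canonical_def)
  have c': "canonical (q + 1) (\<sigma> + N)"
    using can N by (simp add: canonical_def algebra_simps)
  have "x + h * (a + N * d) = val \<rho> (q + 1) (\<sigma> + N)"
    unfolding x val_def by (simp add: algebra_simps)
  then have q: "\<rho> + (q + 1) \<le> \<delta>" using S' S_val_iff[OF *(1,2) c'] by auto
  then have "\<delta> - 1 < \<rho> + h * q - (h - 1) * \<sigma>"
    using neg S_val_iff[OF *] unfolding x by auto
  moreover from this q have "\<sigma> < q"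
  proof (rule_tac ccontr)
    assume "\<not> \<sigma> < q"
    then have "(h - 1) * q \<le> (h - 1) * \<sigma>" using h by (simp add: mult_left_mono)
    then show False using \<open>\<delta> - 1 < _\<close> q by (simp add: algebra_simps)
  qed
  ultimately show False using r_ge[OF *] \<delta> by simp
qed

text \<open>In degree \<open>r - 1\<close> the element \<open>x\<close> is a missing monomial that
  every variable carries into the ring. The reason is maximality of \<open>r\<close>: whenever
  adding a generator seems to raise the second bound to \<open>r + 1\<close>, the new pair cannot be
  canonical, and the exchange move brings the bound back to at most \<open>r\<close>.\<close>

lemma S_socle:
  obtains x where "S r x" "\<not> S (r - 1) x" "S r (x + a)"
    "\<And>s. 1 \<le> s \<Longrightarrow> s \<le> N \<Longrightarrow> S r (x + h * (a + s * d))"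
proof -
  obtain \<rho> q \<sigma> where *: "0 \<le> \<rho>" "\<rho> < h" "canonical q \<sigma>" and \<sigma>: "\<sigma> < q"
    and r: "r = \<rho> + h * q - (h - 1) * \<sigma>"
    by (rule r_attained)
  have can: "0 \<le> q" "0 \<le> \<sigma>" "\<sigma> \<le> N * q" "N * q - \<sigma> < a + N * d"
    using *(3) by (auto simp: canonical_def)
  define x where "x = val \<rho> q \<sigma>"
  have "(h - 1) * (\<sigma> + 1) \<le> (h - 1) * q" using \<sigma> h by (intro mult_left_mono) auto
  \<comment> \<open>The first bound stays at least \<open>h - 1 \<ge> 1\<close> below
    \<open>r\<close>, which leaves room for one more generator.\<close>
  then have cost1: "\<rho> + q + (h - 1) \<le> r" unfolding r by (simp add: algebra_simps)
  have hd: "h * d \<ge> 1" "(h - 1) * a \<ge> 0" using h d a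
    by (auto intro: order_trans[OF _ mult_mono[of 1 h 1 d]])
  show thesis
  proof
    show "S r x" using S_val_iff[OF *] cost1 h r by (simp add: x_def)
    show "\<not> S (r - 1) x" using S_val_iff[OF *] r by (simp add: x_def)
    show "S r (x + a)"
    proof (cases "\<rho> + 1 < h")
      case True
      then show ?thesis using r_ge[of "\<rho> + 1" q \<sigma>] * \<sigma> r by simp
    next
      case False
      \<comment> \<open>For smaller \<open>\<rho>\<close> raising it by 1 would give an element of
        \<open>torsion_degs\<close> equal to \<open>r + 1\<close>. Here the remainder overflows into
        \<open>q\<close>.\<close>
      then have \<rho>: "\<rho> = h - 1" using * by simp
      have xa: "x + a = val 0 (q + 1) \<sigma>" unfolding x_def val_def \<rho> by (simp add: algebra_simps)
      have le: "0 \<le> q + 1" "\<sigma> \<le> N * (q + 1)" using can N by (simp_all add: algebra_simps)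
      have c: "h * (q + 1) - (h - 1) * \<sigma> = r + 1" unfolding r \<rho> by (simp add: algebra_simps)
      have nc: "\<not> canonical (q + 1) \<sigma>" using r_ge[of 0 "q + 1" \<sigma>] c \<sigma> h by auto
      note s = shift_admissible[OF le(1) can(2) le(2) nc]
      show ?thesis
        unfolding xa using s(1-3) s(4)[of 0] s(5) c hd cost1 \<rho> d h
        by (intro S_I[of 0 "q + 1 - d" "\<sigma> + a"]) auto
    qed
    show "S r (x + h * (a + s * d))" if s: "1 \<le> s" "s \<le> N" for s
    proof -
      have xs: "x + h * (a + s * d) = val \<rho> (q + 1) (\<sigma> + s)"
        unfolding x_def val_def by (simp add: algebra_simps)
      have le: "0 \<le> q + 1" "0 \<le> \<sigma> + s" "\<sigma> + s \<le> N * (q + 1)"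
        using can s by (simp_all add: algebra_simps)
      show ?thesis
      \<comment> \<open>The second bound changes by \<open>h - (h - 1) * s\<close>, which is 1 for
        \<open>s = 1\<close> and not positive for \<open>s \<ge> 2\<close>.\<close>
      proof (cases "s = 1 \<and> \<not> canonical (q + 1) (\<sigma> + s)")
        case True
        then have nc: "\<not> canonical (q + 1) (\<sigma> + s)" by blast
        note sa = shift_admissible[OF le nc]
        have c: "\<rho> + (h * (q + 1) - (h - 1) * (\<sigma> + s)) = r + 1"
          using True unfolding r by (simp add: algebra_simps)
        show ?thesis
          unfolding xs using sa(1-3) sa(4)[of \<rho>] sa(5) c hd cost1 * d h
          by (intro S_I[of \<rho> "q + 1 - d" "\<sigma> + s + a"]) auto
      next
        case False
        have "\<rho> + h * (q + 1) - (h - 1) * (\<sigma> + s) \<le> r"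
        proof (cases "s = 1")
          case True
          then show ?thesis using False r_ge[OF *(1,2), of "q + 1" "\<sigma> + s"] \<sigma> by simp
        next
          case False
          then have "(h - 1) * 2 \<le> (h - 1) * s" using s h by (intro mult_left_mono) auto
          then show ?thesis unfolding r using h by (simp add: algebra_simps)
        qed
        then show ?thesis
          unfolding xs using le * cost1 h by (intro S_I[of \<rho> "q + 1" "\<sigma> + s"]) auto
      qed
    qed
  qed
qed

end

section \<open>The coordinate ring of a monomial curve\<close>

definition weight :: "nat \<Rightarrow> (nat \<Rightarrow> int) \<Rightarrow> (nat \<Rightarrow>\<^sub>0 nat) \<Rightarrow> int" where
  "weight N \<mu> t = (\<Sum>i\<in>{1..N}. int (Poly_Mapping.lookup t i) * \<mu> i)"

definition graded_semigroup :: "nat \<Rightarrow> (nat \<Rightarrow> int) \<Rightarrow> int \<Rightarrow> int \<Rightarrow> bool" where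
  "graded_semigroup N \<mu> d y \<longleftrightarrow> (\<exists>t. Poly_Mapping.keys t \<subseteq> {1..N} \<and> int (mon_deg t) = d \<and> weight N \<mu> t = y)"

text \<open>The projection of R onto the semigroup ring, with the exponent of \<open>v\<close>
  dropped. Only coordinate 1 occurs because the free module at step 0 has rank 1.\<close>

definition weight_eval :: "nat \<Rightarrow> (nat \<Rightarrow> int) \<Rightarrow> (nat \<Rightarrow> 'k::comm_ring_1 mpoly) \<Rightarrow> int \<Rightarrow> 'k" where
  "weight_eval N \<mu> x y = (\<Sum>t\<in>Poly_Mapping.keys (x 1). if weight N \<mu> t = y then Poly_Mapping.lookup (x 1) t else 0)"

lemma weight_add: "weight N \<mu> (s + t) = weight N \<mu> s + weight N \<mu> t"
  by (simp add: weight_def lookup_add algebra_simps sum.distrib)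

lemma weight_single: "k \<in> {1..N} \<Longrightarrow> weight N \<mu> (Poly_Mapping.single k (Suc 0)) = \<mu> k"
  by (simp add: weight_def lookup_single when_def if_distrib[of int] if_distrib[of "\<lambda>x. x * _"] cong: if_cong)

lemma weight_eval_superset:
  "finite A \<Longrightarrow> Poly_Mapping.keys (x 1) \<subseteq> A \<Longrightarrow>
    weight_eval N \<mu> x y = (\<Sum>t\<in>A. if weight N \<mu> t = y then Poly_Mapping.lookup (x 1) t else 0)"
  unfolding weight_eval_def by (rule sum.mono_neutral_left) (auto simp: in_keys_iff)

lemma graded_semigroup_module: "semigroup_module {1..N} \<mu> (graded_semigroup N \<mu>)"
proof
  show "graded_semigroup N \<mu> (d + 1) (x + \<mu> k)" if k: "k \<in> {1..N}" and x: "graded_semigroup N \<mu> d x" for k d x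
  proof -
    obtain t where t: "Poly_Mapping.keys t \<subseteq> {1..N}" "int (mon_deg t) = d" "weight N \<mu> t = x"
      using x by (auto simp: graded_semigroup_def)
    then show ?thesis
      unfolding graded_semigroup_def using k
      by (intro exI[of _ "t + Poly_Mapping.single k 1"])
        (auto simp: keys_nat_add mon_deg_add weight_add weight_single)
  qed
qed simp

lemma weight_eval_add: "weight_eval N \<mu> (x + y) = weight_eval N \<mu> x + weight_eval N \<mu> y"
proof
  fix z
  let ?A = "Poly_Mapping.keys (x 1) \<union> Poly_Mapping.keys (y 1)"
  have "Poly_Mapping.keys ((x + y) 1) \<subseteq> ?A" using keys_add[of "x 1" "y 1"] by simp
  then have "weight_eval N \<mu> (x + y) z
      = (\<Sum>t\<in>?A. if weight N \<mu> t = z then Poly_Mapping.lookup ((x + y) 1) t else 0)"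
    by (intro weight_eval_superset) auto
  also have "\<dots> = (\<Sum>t\<in>?A. if weight N \<mu> t = z then Poly_Mapping.lookup (x 1) t else 0)
      + (\<Sum>t\<in>?A. if weight N \<mu> t = z then Poly_Mapping.lookup (y 1) t else 0)"
    by (simp add: sum.distrib[symmetric] lookup_add if_distrib cong: if_cong)
  also have "\<dots> = weight_eval N \<mu> x z + weight_eval N \<mu> y z"
    by (simp add: weight_eval_superset[of ?A x] weight_eval_superset[of ?A y])
  finally show "weight_eval N \<mu> (x + y) z = (weight_eval N \<mu> x + weight_eval N \<mu> y) z" by simp
qed

lemma weight_eval_vec_mult:
  assumes k: "k \<in> {1..N}"
  shows "weight_eval N \<mu> (vec_mult k x) = shift_fun \<mu> k (weight_eval N \<mu> x)"
proof
  fix z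
  define s where "s = Poly_Mapping.single k (1::nat)"
  have weight_s: "weight N \<mu> s = \<mu> k" using weight_single[OF k] by (simp add: s_def)
  have ks: "k \<in> Poly_Mapping.keys s" by (simp add: s_def)
  note lookup_mult = lookup_Var_mult[of k, folded s_def]
  let ?A = "(\<lambda>t. t + s) ` Poly_Mapping.keys (x 1)"
  have sub: "Poly_Mapping.keys (vec_mult k x 1) \<subseteq> ?A"
  proof
    fix t assume "t \<in> Poly_Mapping.keys (vec_mult k x 1)"
    then have "Poly_Mapping.lookup (Var k * x 1) t \<noteq> 0"
      by (simp add: in_keys_iff vec_mult_def)
    then have t: "k \<in> Poly_Mapping.keys t" "t - s \<in> Poly_Mapping.keys (x 1)"
      unfolding lookup_mult in_keys_iff[of _ "x 1"] by (auto split: if_splits)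
    have "t - s + s = t" using sqfree_mon_minus_add[of "{k}" t] t(1) by (simp add: sqfree_mon_def s_def)
    then show "t \<in> ?A" using t(2) by (metis imageI)
  qed
  have "weight_eval N \<mu> (vec_mult k x) z
      = (\<Sum>t\<in>?A. if weight N \<mu> t = z then Poly_Mapping.lookup (vec_mult k x 1) t else 0)"
    by (rule weight_eval_superset) (use sub in simp_all)
  also have "\<dots> = (\<Sum>t\<in>Poly_Mapping.keys (x 1).
      if weight N \<mu> (t + s) = z then Poly_Mapping.lookup (vec_mult k x 1) (t + s) else 0)"
    by (subst sum.reindex) (auto intro: inj_onI)
  also have "\<dots> = (\<Sum>t\<in>Poly_Mapping.keys (x 1). if weight N \<mu> t = z - \<mu> k then Poly_Mapping.lookup (x 1) t else 0)"
    using ks by (intro sum.cong) (auto simp: weight_add weight_s vec_mult_def lookup_mult keys_nat_add)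
  finally show "weight_eval N \<mu> (vec_mult k x) z = shift_fun \<mu> k (weight_eval N \<mu> x) z"
    by (simp add: shift_fun_def weight_eval_def)
qed

lemma weight_eval_image:
  assumes e: "e 1 = 0"
  shows "weight_eval N \<mu> ` free_comp N 1 e d
    = (supp_comp (graded_semigroup N \<mu>) d :: (int \<Rightarrow> 'k::comm_ring_1) set)"
proof
  show "weight_eval N \<mu> ` free_comp N 1 e d \<subseteq> (supp_comp (graded_semigroup N \<mu>) d :: (int \<Rightarrow> 'k) set)"
  proof safe
    fix x :: "nat \<Rightarrow> 'k mpoly" assume x: "x \<in> free_comp N 1 e d"
    show "weight_eval N \<mu> x \<in> supp_comp (graded_semigroup N \<mu>) d"
      unfolding supp_comp_def
    proof safe
      fix y assume "weight_eval N \<mu> x y \<noteq> 0"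
      then obtain t where t: "(if weight N \<mu> t = y then Poly_Mapping.lookup (x 1) t else 0) \<noteq> 0"
        unfolding weight_eval_def by (rule sum.not_neutral_contains_not_neutral)
      then have "weight N \<mu> t = y" "Poly_Mapping.lookup (x 1) t \<noteq> 0" by (auto split: if_splits)
      moreover from this have "Poly_Mapping.keys t \<subseteq> {1..N} \<and> int (mon_deg t) = d - e 1"
        using x unfolding free_comp_iff by blast
      ultimately show "graded_semigroup N \<mu> d y" using e by (auto simp: graded_semigroup_def)
    qed
  qed
  show "(supp_comp (graded_semigroup N \<mu>) d :: (int \<Rightarrow> 'k) set) \<subseteq> weight_eval N \<mu> ` free_comp N 1 e d"
  proof
    fix g :: "int \<Rightarrow> 'k" assume g: "g \<in> supp_comp (graded_semigroup N \<mu>) d"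
    then have "\<forall>y. \<exists>t. g y \<noteq> 0 \<longrightarrow> Poly_Mapping.keys t \<subseteq> {1..N} \<and> int (mon_deg t) = d \<and> weight N \<mu> t = y"
      by (auto simp: supp_comp_def graded_semigroup_def)
    \<comment> \<open>One monomial is chosen for each weight in the support; the preimage of
      \<open>g\<close> uses these monomials only.\<close>
    then obtain \<tau> where \<tau>: "\<And>y. g y \<noteq> 0 \<Longrightarrow>
        Poly_Mapping.keys (\<tau> y) \<subseteq> {1..N} \<and> int (mon_deg (\<tau> y)) = d \<and> weight N \<mu> (\<tau> y) = y"
      by metis
    define f where "f = Abs_poly_mapping (\<lambda>t. if t = \<tau> (weight N \<mu> t) then g (weight N \<mu> t) else 0)"
    have sub: "{t. (if t = \<tau> (weight N \<mu> t) then g (weight N \<mu> t) else 0) \<noteq> 0}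
        \<subseteq> {t. Poly_Mapping.keys t \<subseteq> {1..N} \<and> mon_deg t \<le> nat d}"
    proof
      fix t assume "t \<in> {t. (if t = \<tau> (weight N \<mu> t) then g (weight N \<mu> t) else 0) \<noteq> 0}"
      then have "t = \<tau> (weight N \<mu> t)" "g (weight N \<mu> t) \<noteq> 0" by (auto split: if_splits)
      with \<tau>[of "weight N \<mu> t"] show "t \<in> {t. Poly_Mapping.keys t \<subseteq> {1..N} \<and> mon_deg t \<le> nat d}"
        by auto
    qed
    have lookup_f: "Poly_Mapping.lookup f t = (if t = \<tau> (weight N \<mu> t) then g (weight N \<mu> t) else 0)" for t
      unfolding f_def using finite_subset[OF sub finite_monomials] by simp
    define x where "x = (\<lambda>j::nat. if j = 1 then f else 0)"
    have "x \<in> free_comp N 1 e d"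
      unfolding free_comp_iff
    proof (intro allI impI)
      fix j t assume nz: "Poly_Mapping.lookup (x j) t \<noteq> 0"
      then have j: "j = 1" by (auto simp: x_def split: if_splits)
      then have "t = \<tau> (weight N \<mu> t)" "g (weight N \<mu> t) \<noteq> 0"
        using nz by (auto simp: x_def lookup_f split: if_splits)
      with \<tau>[of "weight N \<mu> t"] j e
      show "j \<in> {1..1} \<and> Poly_Mapping.keys t \<subseteq> {1..N} \<and> int (mon_deg t) = d - e j" by auto
    qed
    moreover have "weight_eval N \<mu> x y = g y" for y
    proof -
      have "weight_eval N \<mu> x y
          = (\<Sum>t\<in>insert (\<tau> y) (Poly_Mapping.keys f). if weight N \<mu> t = y then Poly_Mapping.lookup (x 1) t else 0)"
        by (rule weight_eval_superset) (auto simp: x_def)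
      also have "\<dots> = (\<Sum>t\<in>insert (\<tau> y) (Poly_Mapping.keys f). if t = \<tau> y then g y else 0)"
        using \<tau>[of y] by (intro sum.cong) (auto simp: x_def lookup_f)
      also have "\<dots> = g y" by simp
      finally show ?thesis .
    qed
    ultimately show "g \<in> weight_eval N \<mu> ` free_comp N 1 e d" by (metis ext imageI)
  qed
qed

lemma weight_eval_ses:
  assumes e: "e 1 = 0"
  shows "koszul_ses {1..N} vec_mult (free_comp N 1 e) (shift_fun \<mu>)
    (supp_comp (graded_semigroup N \<mu>)) (weight_eval N \<mu> :: (nat \<Rightarrow> 'k::comm_ring_1 mpoly) \<Rightarrow> int \<Rightarrow> 'k)"
proof -
  interpret F: graded_koszul "{1..N}" vec_mult "free_comp N 1 e :: int \<Rightarrow> (nat \<Rightarrow> 'k mpoly) set"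
    by (rule free_comp_graded)
  interpret M: graded_koszul "{1..N}" "shift_fun \<mu>"
    "supp_comp (graded_semigroup N \<mu>) :: int \<Rightarrow> (int \<Rightarrow> 'k) set"
    by (rule semigroup_module.supp_comp_graded[OF graded_semigroup_module])
  show ?thesis
    by unfold_locales
      (simp_all only: weight_eval_add weight_eval_vec_mult weight_eval_image[of e, OF e])
qed

section \<open>The vanishing ideal in terms of weights\<close>

definition uv_mon :: "nat \<Rightarrow> nat \<Rightarrow> nat \<Rightarrow>\<^sub>0 nat" where
  "uv_mon a b = Poly_Mapping.single 1 a + Poly_Mapping.single 2 b"

lemma uv_mon_add: "uv_mon a b + uv_mon a' b' = uv_mon (a + a') (b + b')"
  by (simp add: uv_mon_def single_add algebra_simps)

lemma uv_mon_eq_iff: "uv_mon a b = uv_mon a' b' \<longleftrightarrow> a = a' \<and> b = b'"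
proof
  assume eq: "uv_mon a b = uv_mon a' b'"
  have "Poly_Mapping.lookup (uv_mon a b) 1 = a" "Poly_Mapping.lookup (uv_mon a b) 2 = b" for a b
    by (simp_all add: uv_mon_def lookup_add lookup_single when_def)
  then show "a = a' \<and> b = b'" using eq by metis
qed simp

lemma uv_mon_power:
  "(Poly_Mapping.single (uv_mon a b) 1 :: 'k::comm_ring_1 mpoly) ^ k = Poly_Mapping.single (uv_mon (k * a) (k * b)) 1"
proof (induction k)
  case 0
  have "uv_mon 0 0 = 0" by (simp add: uv_mon_def)
  then show ?case by simp
next
  case (Suc k)
  then show ?case by (simp add: mult_single uv_mon_add)
qed

lemma uv_mon_prod:
  "finite I \<Longrightarrow> (\<Prod>i\<in>I. Poly_Mapping.single (uv_mon (f i) (g i)) 1 :: 'k::comm_ring_1 mpoly)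
    = Poly_Mapping.single (uv_mon (sum f I) (sum g I)) 1"
proof (induction I rule: finite_induct)
  case empty
  have "uv_mon 0 0 = 0" by (simp add: uv_mon_def)
  then show ?case by simp
next
  case (insert i I)
  then show ?case by (simp add: mult_single uv_mon_add)
qed

lemma Var_1_eq: "(Var 1 :: 'k::comm_ring_1 mpoly) = Poly_Mapping.single (uv_mon 1 0) 1"
  by (simp add: Var_def uv_mon_def)

lemma Var_2_eq: "(Var 2 :: 'k::comm_ring_1 mpoly) = Poly_Mapping.single (uv_mon 0 1) 1"
  by (simp add: Var_def uv_mon_def)

definition u_exponent :: "nat \<Rightarrow> (nat \<Rightarrow> nat) \<Rightarrow> nat \<Rightarrow> nat" where
  "u_exponent n m i = (if i \<le> n then m i else 0)"

lemma curve_param_eq: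
  "(curve_param n m i :: 'k::comm_ring_1 mpoly)
    = Poly_Mapping.single (uv_mon (u_exponent n m i) (m n - u_exponent n m i)) 1"
  unfolding curve_param_def u_exponent_def Var_1_eq Var_2_eq uv_mon_power mult_single uv_mon_add
  by simp

text \<open>The exponents of \<open>u\<close> and \<open>v\<close> in the image of a monomial add up
  to \<open>m n\<close> times its degree. So on a homogeneous polynomial substitution merges exactly
  the monomials of equal weight, and its coefficients are those of
  \<open>weight_eval\<close>.\<close>

lemma vanishing_ideal_iff_weight_eval:
  fixes x :: "nat \<Rightarrow> 'k::comm_ring_1 mpoly"
  assumes e: "e 1 = 0" and x: "x \<in> free_comp (n + 1) 1 e d"
    and m: "\<And>i. i \<in> {1..n} \<Longrightarrow> m i \<le> m n"
  shows "weight_eval (n + 1) (\<lambda>i. int (u_exponent n m i)) x = 0 \<longleftrightarrow> x 1 \<in> vanishing_ideal n m"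
proof -
  let ?w = "weight (n + 1) (\<lambda>i. int (u_exponent n m i))"
  let ?K = "Poly_Mapping.keys (x 1)"
  let ?c = "Poly_Mapping.lookup (x 1)"
  define a where "a t = (\<Sum>i\<in>{1..n + 1}. Poly_Mapping.lookup t i * u_exponent n m i)" for t
  define b where "b t = (\<Sum>i\<in>{1..n + 1}. Poly_Mapping.lookup t i * (m n - u_exponent n m i))" for t
  have K: "Poly_Mapping.keys t \<subseteq> {1..n + 1} \<and> int (mon_deg t) = d" if "t \<in> ?K" for t
  proof -
    have "Poly_Mapping.lookup (x 1) t \<noteq> 0" using that by (simp add: in_keys_iff)
    then have "Poly_Mapping.keys t \<subseteq> {1..n + 1} \<and> int (mon_deg t) = d - e 1"
      using x unfolding free_comp_iff by blast
    then show ?thesis using e by simp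
  qed
  have ab: "a t + b t = mon_deg t * m n" if "t \<in> ?K" for t
  proof -
    have le: "u_exponent n m i \<le> m n" if "i \<in> {1..n + 1}" for i
      using m that by (simp add: u_exponent_def)
    have "a t + b t = (\<Sum>i\<in>{1..n + 1}. Poly_Mapping.lookup t i * m n)"
      unfolding a_def b_def sum.distrib[symmetric]
      by (rule sum.cong) (auto simp: distrib_left[symmetric] le)
    also have "\<dots> = mon_deg t * m n"
    proof -
      have "mon_deg t = (\<Sum>i\<in>{1..n + 1}. Poly_Mapping.lookup t i)"
        using K[OF that] by (intro mon_deg_eq_sum) auto
      then show ?thesis by (simp only: sum_distrib_right)
    qed
    finally show ?thesis .
  qed
  have w: "?w t = int (a t)" for t by (simp add: weight_def a_def)
  have eq_iff: "uv_mon (a t) (b t) = uv_mon (a t') (b t') \<longleftrightarrow> ?w t = ?w t'" if "t \<in> ?K" "t' \<in> ?K" for t t'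
    using ab[OF that(1)] ab[OF that(2)] K[OF that(1)] K[OF that(2)] unfolding uv_mon_eq_iff w by auto
  have "subst_hom (curve_param n m) (x 1) = (\<Sum>t\<in>?K. Poly_Mapping.single (uv_mon (a t) (b t)) (?c t))"
    unfolding subst_hom_def
  proof (rule sum.cong)
    fix t assume t: "t \<in> ?K"
    have "(\<Prod>i\<in>Poly_Mapping.keys t. curve_param n m i ^ Poly_Mapping.lookup t i)
        = (\<Prod>i\<in>{1..n + 1}. curve_param n m i ^ Poly_Mapping.lookup t i :: 'k mpoly)"
      using K[OF t] by (intro prod.mono_neutral_left) (auto simp: in_keys_iff)
    also have "\<dots> = Poly_Mapping.single (uv_mon (a t) (b t)) 1"
      unfolding curve_param_eq uv_mon_power uv_mon_prod[OF finite_atLeastAtMost] a_def b_def ..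
    finally show "Const (?c t) * (\<Prod>i\<in>Poly_Mapping.keys t. curve_param n m i ^ Poly_Mapping.lookup t i)
        = Poly_Mapping.single (uv_mon (a t) (b t)) (?c t)"
      by (simp add: Const_def mult_single)
  qed simp
  then have lookup: "Poly_Mapping.lookup (subst_hom (curve_param n m) (x 1)) s
      = (\<Sum>t\<in>?K. if uv_mon (a t) (b t) = s then ?c t else 0)" for s
    by (simp only: lookup_sum lookup_single when_def)
  have at: "Poly_Mapping.lookup (subst_hom (curve_param n m) (x 1)) (uv_mon (a t) (b t))
      = weight_eval (n + 1) (\<lambda>i. int (u_exponent n m i)) x (?w t)" if "t \<in> ?K" for t
    unfolding lookup weight_eval_def using eq_iff[OF _ that] by (intro sum.cong) auto
  have "x 1 \<in> poly_ring (n + 1)" using x by (simp add: free_comp_def free_mod_def)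
  then have "x 1 \<in> vanishing_ideal n m \<longleftrightarrow> subst_hom (curve_param n m) (x 1) = 0"
    by (simp add: vanishing_ideal_def)
  also have "\<dots> \<longleftrightarrow> weight_eval (n + 1) (\<lambda>i. int (u_exponent n m i)) x = 0"
  proof
    assume z: "subst_hom (curve_param n m) (x 1) = 0"
    show "weight_eval (n + 1) (\<lambda>i. int (u_exponent n m i)) x = 0"
    proof
      fix y
      show "weight_eval (n + 1) (\<lambda>i. int (u_exponent n m i)) x y = 0 y"
      proof (cases "\<exists>t\<in>?K. ?w t = y")
        case True
        then show ?thesis using at z by auto
      next
        case False
        then show ?thesis by (auto simp: weight_eval_def intro!: sum.neutral)
      qed
    qed
  next
    assume z: "weight_eval (n + 1) (\<lambda>i. int (u_exponent n m i)) x = 0"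
    show "subst_hom (curve_param n m) (x 1) = 0"
    proof (rule poly_mapping_eqI)
      fix s
      show "Poly_Mapping.lookup (subst_hom (curve_param n m) (x 1)) s = Poly_Mapping.lookup 0 s"
      proof (cases "\<exists>t\<in>?K. uv_mon (a t) (b t) = s")
        case True
        then show ?thesis using at z by auto
      next
        case False
        then show ?thesis unfolding lookup by (auto intro!: sum.neutral)
      qed
    qed
  qed
  finally show ?thesis ..
qed

section \<open>The semigroup of the curve and the shifts of its resolutions\<close>

context divisible_arith_seq
begin

text \<open>Here \<open>c\<close> counts the generators with index 2 to \<open>n\<close>, and each
  adds between 1 and \<open>N\<close> to \<open>\<sigma>\<close>; hence
  \<open>c \<le> \<sigma> \<le> N * c\<close>. The copies of \<open>m 1\<close> are divided by
  \<open>h\<close>, with quotient \<open>k\<close> going into \<open>q = k + c\<close>. Both bounds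
  then follow from \<open>f 1 + c \<le> \<delta>\<close>.\<close>

lemma graded_semigroup_imp_S:
  assumes n: "N = int n - 1" and \<mu>1: "\<mu> 1 = a" and \<mu>: "\<And>i. i \<in> {2..n} \<Longrightarrow> \<mu> i = h * (a + (int i - 1) * d)"
    and \<mu>0: "\<mu> (n + 1) = 0" and x: "graded_semigroup (n + 1) \<mu> \<delta> x"
  shows "S \<delta> x"
proof -
  obtain t where t: "Poly_Mapping.keys t \<subseteq> {1..n + 1}" "int (mon_deg t) = \<delta>" "weight (n + 1) \<mu> t = x"
    using x by (auto simp: graded_semigroup_def)
  define f where "f i = int (Poly_Mapping.lookup t i)" for i
  have f: "f i \<ge> 0" for i by (simp add: f_def)
  define c where "c = (\<Sum>i\<in>{2..n}. f i)"
  define \<sigma> where "\<sigma> = (\<Sum>i\<in>{2..n}. (int i - 1) * f i)"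
  have n2: "n \<ge> 2" using n N by linarith
  have range: "{1..n + 1} = insert 1 (insert (n + 1) {2..n})" using n2 by auto
  have "\<delta> = (\<Sum>i\<in>{1..n + 1}. f i)"
    using t(2) mon_deg_eq_sum[OF _ t(1)] by (simp add: f_def)
  also have "\<dots> = f 1 + f (n + 1) + c"
    unfolding range c_def using n2 by simp
  finally have \<delta>: "f 1 + c \<le> \<delta>" using f[of "n + 1"] by simp
  have "x = (\<Sum>i\<in>{1..n + 1}. f i * \<mu> i)" using t(3) by (simp add: weight_def f_def)
  also have "\<dots> = f 1 * a + (\<Sum>i\<in>{2..n}. f i * \<mu> i)"
    unfolding range using n2 \<mu>1 \<mu>0 by simp
  also have "(\<Sum>i\<in>{2..n}. f i * \<mu> i) = (\<Sum>i\<in>{2..n}. h * (a * f i + d * ((int i - 1) * f i)))"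
    by (rule sum.cong) (auto simp: \<mu> algebra_simps)
  also have "\<dots> = h * (c * a + d * \<sigma>)"
    by (simp add: c_def \<sigma>_def sum_distrib_left[symmetric] sum.distrib mult.commute)
  finally have x: "x = f 1 * a + h * (c * a + d * \<sigma>)" .
  have "c \<le> \<sigma>"
    unfolding c_def \<sigma>_def
  proof (rule sum_mono)
    fix i assume "i \<in> {2..n}"
    then have "1 * f i \<le> (int i - 1) * f i" using f by (intro mult_right_mono) auto
    then show "f i \<le> (int i - 1) * f i" by simp
  qed
  have "\<sigma> \<le> N * c"
    unfolding c_def \<sigma>_def sum_distrib_left n using f by (intro sum_mono mult_right_mono) auto
  define k where "k = f 1 div h"
  have k: "k \<ge> 0" using f[of 1] h by (simp add: k_def pos_imp_zdiv_nonneg_iff)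
  have f1: "f 1 = f 1 mod h + h * k" by (simp add: k_def)
  have c: "c \<ge> 0" unfolding c_def using f by (intro sum_nonneg) auto
  have "1 * k \<le> h * k" using k h by (intro mult_right_mono) auto
  then have kk: "f 1 mod h + k \<le> f 1" using f1 by linarith
  show ?thesis
  proof (rule S_I)
    show "0 \<le> f 1 mod h" "f 1 mod h < h" using h by simp_all
    show "0 \<le> k + c" "0 \<le> \<sigma>" using k c \<open>c \<le> \<sigma>\<close> by simp_all
    have "0 \<le> N * k" using N k by simp
    then show "\<sigma> \<le> N * (k + c)" using \<open>\<sigma> \<le> N * c\<close> by (simp add: distrib_left)
    show "x = val (f 1 mod h) (k + c) \<sigma>"
      unfolding val_def x by (subst f1) (simp add: algebra_simps)
    show "f 1 mod h + (k + c) \<le> \<delta>" using kk \<delta> by simp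
    have "(h - 1) * c \<le> (h - 1) * \<sigma>" using \<open>c \<le> \<sigma>\<close> h by (intro mult_left_mono) auto
    moreover have "f 1 mod h + h * (k + c) = f 1 + (h - 1) * c + c"
      by (subst (2) f1) (simp add: algebra_simps)
    ultimately show "f 1 mod h + h * (k + c) - (h - 1) * \<sigma> \<le> \<delta>" using \<delta> by linarith
  qed
qed

text \<open>The cheapest realization uses as many of the other generators as possible, namely the
  minimum of \<open>q\<close> and \<open>\<sigma>\<close>. The rest of \<open>q\<close> is paid for
  with \<open>h\<close> copies of \<open>m 1\<close> each, and the weight 0 generator fills up the
  degree. The total before filling up is the larger bound in \<open>S\<close>.\<close>

lemma S_imp_graded_semigroup:
  assumes n: "N = int n - 1" and \<mu>1: "\<mu> 1 = a" and \<mu>: "\<And>i. i \<in> {2..n} \<Longrightarrow> \<mu> i = h * (a + (int i - 1) * d)"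
    and \<mu>0: "\<mu> (n + 1) = 0" and x: "S \<delta> x"
  shows "graded_semigroup (n + 1) \<mu> \<delta> x"
proof -
  interpret semigroup_module "{1..n + 1}" \<mu> "graded_semigroup (n + 1) \<mu>"
    by (rule graded_semigroup_module)
  let ?G = "graded_semigroup (n + 1) \<mu>"
  have add_last: "?G (\<delta> + int k) y" if "?G \<delta> y" for \<delta> y k
  proof (induction k)
    case (Suc k)
    from S_add[OF _ this, of "n + 1"] \<mu>0 show ?case by (simp add: algebra_simps)
  qed (use that in simp)
  have add_first: "?G (\<delta> + int k) (y + int k * a)" if "?G \<delta> y" for \<delta> y k
  proof (induction k)
    case (Suc k)
    from S_add[OF _ this, of 1] \<mu>1 show ?case by (simp add: algebra_simps)
  qed (use that in simp)
  have middle: "?G (int c) (h * (int c * a + d * \<sigma>))" if "int c \<le> \<sigma>" "\<sigma> \<le> N * int c" for c \<sigma>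
    using that
  proof (induction c arbitrary: \<sigma>)
    case 0
    have "?G 0 0" unfolding graded_semigroup_def by (intro exI[of _ 0]) (simp add: weight_def)
    then show ?case using 0 by simp
  next
    case (Suc c)
    \<comment> \<open>The smallest step that leaves at most \<open>N * int c\<close> for the
      remaining \<open>c\<close> generators; being smallest, it also leaves at least
      \<open>int c\<close>.\<close>
    define s where "s = max 1 (\<sigma> - N * int c)"
    have "1 * int c \<le> N * int c" using N by (intro mult_right_mono) auto
    then have s: "1 \<le> s" "s \<le> N" "int c \<le> \<sigma> - s" "\<sigma> - s \<le> N * int c"
      using Suc.prems N by (auto simp: s_def algebra_simps)
    have "nat s + 1 \<in> {2..n}" "int (nat s + 1) - 1 = s" using s n by auto
    then have "\<mu> (nat s + 1) = h * (a + s * d)" using \<mu> by metis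
    moreover have "?G (int c + 1) (h * (int c * a + d * (\<sigma> - s)) + \<mu> (nat s + 1))"
      using s n by (intro S_add Suc.IH) auto
    ultimately show ?case by (simp add: algebra_simps)
  qed
  obtain \<rho> q \<sigma> where *: "0 \<le> \<rho>" "\<rho> < h" "0 \<le> q" "0 \<le> \<sigma>" "\<sigma> \<le> N * q" "x = val \<rho> q \<sigma>"
    "\<rho> + q \<le> \<delta>" "\<rho> + h * q - (h - 1) * \<sigma> \<le> \<delta>"
    using x unfolding S_def by blast
  define c where "c = min q \<sigma>"
  have "1 * \<sigma> \<le> N * \<sigma>" using N * by (intro mult_right_mono) auto
  then have c: "0 \<le> c" "c \<le> \<sigma>" "\<sigma> \<le> N * c" "c \<le> q" using * by (auto simp: c_def min_def)
  define b where "b = \<rho> + h * (q - c)"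
  have b: "b \<ge> 0" using * c h by (simp add: b_def)
  have "?G c (h * (c * a + d * \<sigma>))" using middle[of "nat c" \<sigma>] c by simp
  from add_first[OF this, of "nat b"] b
  have "?G (c + b) (h * (c * a + d * \<sigma>) + b * a)" by simp
  moreover have "h * (c * a + d * \<sigma>) + b * a = x"
    unfolding b_def *(6) val_def by (simp add: algebra_simps)
  moreover have "c + b \<le> \<delta>"
    using * unfolding b_def c_def by (auto simp: min_def algebra_simps)
  ultimately show ?thesis using add_last[of "c + b" x "nat (\<delta> - (c + b))"] by simp
qed

lemma graded_semigroup_eq_S:
  assumes "N = int n - 1" "\<mu> 1 = a" "\<And>i. i \<in> {2..n} \<Longrightarrow> \<mu> i = h * (a + (int i - 1) * d)" "\<mu> (n + 1) = 0"
  shows "graded_semigroup (n + 1) \<mu> = S"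
  using graded_semigroup_imp_S[OF assms] S_imp_graded_semigroup[OF assms] by blast

text \<open>The algebraic and the arithmetic part meet here, with the variables \<open>n\<close> and
  \<open>n + 1\<close> as apexes \<open>v\<close> and \<open>w\<close> of the two cones.\<close>

lemma curve_resolution_shifts:
  fixes \<phi> :: "nat \<Rightarrow> (nat \<Rightarrow> 'k::comm_ring_1 mpoly) \<Rightarrow> nat \<Rightarrow> 'k mpoly"
  assumes n: "N = int n - 1" and m1: "int (m 1) = a"
    and m: "\<And>i. i \<in> {2..n} \<Longrightarrow> int (m i) = h * (a + (int i - 1) * d)"
    and mono: "\<And>i. i \<in> {1..n} \<Longrightarrow> m i \<le> m n"
    and res: "is_min_graded_free_res (n + 1) (vanishing_ideal n m) p \<beta> e \<phi>"
  shows "p = n" "\<And>i j. i \<in> {1..p} \<Longrightarrow> j \<in> {1..\<beta> i} \<Longrightarrow> e i j - int i \<le> r"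
    "\<exists>j\<in>{1..\<beta> p}. e p j - int p = r"
proof -
  define \<mu> where "\<mu> i = int (u_exponent n m i)" for i
  have n2: "n \<ge> 2" using n N by linarith
  have \<mu>1: "\<mu> 1 = a" and \<mu>: "\<And>i. i \<in> {2..n} \<Longrightarrow> \<mu> i = h * (a + (int i - 1) * d)"
    and \<mu>0: "\<mu> (n + 1) = 0"
    using n2 m1 m by (auto simp: \<mu>_def u_exponent_def)
  have G: "graded_semigroup (n + 1) \<mu> = S"
    by (rule graded_semigroup_eq_S[OF n \<mu>1 \<mu> \<mu>0])
  have \<mu>n: "\<mu> n = h * (a + N * d)" using \<mu>[of n] n n2 by simp
  interpret M: semigroup_module "{1..n + 1}" \<mu> S
    using graded_semigroup_module[of "n + 1" \<mu>] unfolding G .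
  have p: "p \<ge> 1" and b0: "\<beta> 0 = 1" and e0: "e 0 1 = 0" and bp: "\<beta> p \<noteq> 0"
    using res by (auto simp: is_min_graded_free_res_def)
  interpret R: resolution "n + 1" "vanishing_ideal n m" p \<beta> e \<phi> "shift_fun \<mu>" "supp_comp S"
    "weight_eval (n + 1) \<mu>"
  proof (rule resolution.intro)
    show "is_min_graded_free_res (n + 1) (vanishing_ideal n m) p \<beta> e \<phi>" by (rule res)
    show "koszul_ses {1..n + 1} vec_mult (free_comp (n + 1) (\<beta> 0) (e 0)) (shift_fun \<mu>) (supp_comp S)
        (weight_eval (n + 1) \<mu> :: (nat \<Rightarrow> 'k mpoly) \<Rightarrow> int \<Rightarrow> 'k)"
      using weight_eval_ses[of "e 0" "n + 1" \<mu>, OF e0] unfolding G b0 .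
    show "weight_eval (n + 1) \<mu> x = 0 \<longleftrightarrow> x 1 \<in> vanishing_ideal n m"
      if "x \<in> free_comp (n + 1) (\<beta> 0) (e 0) d" for x :: "nat \<Rightarrow> 'k mpoly" and d
      using vanishing_ideal_iff_weight_eval[of "e 0" x n d m, OF e0 that[unfolded b0] mono]
      unfolding \<mu>_def .
  qed simp
  have exact: "kexact {1..n + 1} (shift_fun \<mu>) (supp_comp S :: int \<Rightarrow> (int \<Rightarrow> 'k) set) q D"
    if "D - int q > r" for q D
  proof (rule M.supp_comp_kexact[of n "n + 1", OF _ _ that])
    show "S (\<delta> - 1) (x - \<mu> n) \<or> S (\<delta> - 1) (x - \<mu> (n + 1))" if "r < \<delta>" "S \<delta> x" for \<delta> x
      using S_diff_last[OF that] by (simp add: \<mu>0[simplified] \<mu>n)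
    show "S (\<delta> - 1) (x - \<mu> (n + 1))" if "r < \<delta>" "S \<delta> x" "S \<delta> (x + \<mu> n - \<mu> (n + 1))" for \<delta> x
      using S_cancel_last[of \<delta> x] that by (simp add: \<mu>0[simplified] \<mu>n)
  qed (use n2 in auto)
  show shifts: "e i j - int i \<le> r" if i: "i \<in> {1..p}" and j: "j \<in> {1..\<beta> i}" for i j
  proof (rule ccontr)
    assume "\<not> ?thesis"
    then have "kexact {1..n + 1} (shift_fun \<mu>) (supp_comp S :: int \<Rightarrow> (int \<Rightarrow> 'k) set) i (e i j)"
      by (intro exact) simp
    then show False using R.kexact_iff_no_shift[OF i] j by blast
  qed
  obtain y where y: "S r y" "\<not> S (r - 1) y" "S r (y + a)"
    "\<And>s. 1 \<le> s \<Longrightarrow> s \<le> N \<Longrightarrow> S r (y + h * (a + s * d))"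
    by (rule S_socle) blast
  have "S r (y + \<mu> k)" if "k \<in> {1..n + 1}" for k
  proof -
    have "k = 1 \<or> k = n + 1 \<or> k \<in> {2..n}" using that by (simp, arith)
    then consider "k = 1" | "k = n + 1" | "k \<in> {2..n}" by blast
    then show ?thesis
    proof cases
      case 3
      then have "1 \<le> int k - 1" "int k - 1 \<le> N" using n by auto
      from y(4)[OF this] show ?thesis using \<mu>[OF 3] by simp
    qed (use y(1,3) \<mu>0 \<mu>1 in auto)
  qed
  then have not_exact:
    "\<not> kexact {1..n + 1} (shift_fun \<mu>) (supp_comp S :: int \<Rightarrow> (int \<Rightarrow> 'k) set) n (r + int n)"
    by (intro M.supp_comp_not_kexact[of "n + 1" _ _ r y]) (use \<mu>0 y(2) in auto)
  \<comment> \<open>Koszul homology is nonzero at step \<open>n\<close> but vanishes beyond the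
    length of the resolution. The converse bound holds because a shift at step \<open>p\<close>
    needs nonzero homology there, while it vanishes from step \<open>n + 1\<close> on.\<close>
  have "n \<le> p"
    using not_exact R.kexact_above[of n] by force
  moreover have "p \<le> n"
  proof (rule ccontr)
    assume "\<not> p \<le> n"
    then have "kexact {1..n + 1} (shift_fun \<mu>) (supp_comp S :: int \<Rightarrow> (int \<Rightarrow> 'k) set) p (e p 1)"
      by (intro M.supp_comp_kexact_top[of "n + 1"]) (use \<mu>0 in auto)
    then show False using R.kexact_iff_no_shift[of p] p bp by auto
  qed
  ultimately show pn: "p = n" by simp
  have "\<exists>j\<in>{1..\<beta> n}. e n j = r + int n"
    using not_exact R.kexact_iff_no_shift[of n "r + int n"] p pn by auto
  then show "\<exists>j\<in>{1..\<beta> p}. e p j - int p = r" unfolding pn by (simp add: eq_diff_eq diff_eq_eq)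
qed

end

theorem corollary3p15:
  fixes n h d p :: nat and m :: "nat \<Rightarrow> nat"
    and \<beta> :: "nat \<Rightarrow> nat" and e :: "nat \<Rightarrow> nat \<Rightarrow> int"
    and \<phi> :: "nat \<Rightarrow> (nat \<Rightarrow> 'k::field mpoly) \<Rightarrow> (nat \<Rightarrow> 'k mpoly)"
  assumes "infinite (UNIV :: 'k set)"
    and "n \<ge> 3"
    and "m 1 > 0" and "strict_mono_on {1..n} m"
    and "h > 0" and "d > 0"
    and "\<forall>i \<in> {2..n}. m i = h * m 1 + (i - 1) * d"
    and "gcd (m 1) d = 1"
    and "h > 1" and "h dvd d"
    and "is_min_graded_free_res (n + 1) (vanishing_ideal n m) p \<beta> e \<phi>"
  shows "reg_quot (n + 1) (vanishing_ideal n m :: 'k mpoly set)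
         = Max {e p j - int p | j. j \<in> {1..\<beta> p}}"
proof -
  obtain d' where d': "d = h * d'" using assms(10) by (elim dvdE)
  have cop: "coprime (m 1) d" using assms(8) by (simp add: coprime_iff_gcd_eq_1)
  \<comment> \<open>Here \<open>h dvd d\<close> makes all generators but the first multiples of
    \<open>h\<close>, and \<open>gcd (m 1) d = 1\<close> passes to both factors of
    \<open>d\<close>.\<close>
  interpret divisible_arith_seq "int (m 1)" "int d'" "int h" "int n - 1"
  proof
    show "coprime (int (m 1)) (int h)" "coprime (int (m 1)) (int d')"
      using cop unfolding d' by (simp_all add: coprime_int_iff)
    show "1 \<le> int d'" using assms(6) d' by (cases d') auto
  qed (use assms in auto)
  have m: "int (m i) = int h * (int (m 1) + (int i - 1) * int d')" if "i \<in> {2..n}" for i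
  proof -
    have "int (m i) = int (h * m 1 + (i - 1) * (h * d'))" using assms(7) that unfolding d' by simp
    also have "\<dots> = int h * int (m 1) + int (i - 1) * (int h * int d')" by simp
    also have "int (i - 1) = int i - 1" using that by simp
    finally show ?thesis by (simp add: algebra_simps)
  qed
  have mono: "m i \<le> m n" if "i \<in> {1..n}" for i
    using strict_mono_onD[OF assms(4), of i n] that by (cases "i = n") auto
  note shifts = curve_resolution_shifts[OF refl refl m mono]
  \<comment> \<open>Stated for every resolution, since the definite description in
    \<open>reg_quot\<close> needs the maximum to be independent of the choice.\<close>
  have Max_all: "Max {e' i j - int i | i j. i \<in> {1..p'} \<and> j \<in> {1..\<beta>' i}} = r"
    if res: "is_min_graded_free_res (n + 1) (vanishing_ideal n m :: 'k mpoly set) p' \<beta>' e' \<phi>'"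
    for p' \<beta>' e' \<phi>'
  proof (rule Max_eqI)
    have "{e' i j - int i | i j. i \<in> {1..p'} \<and> j \<in> {1..\<beta>' i}}
        = (\<lambda>(i, j). e' i j - int i) ` (SIGMA i:{1..p'}. {1..\<beta>' i})" by force
    then show "finite {e' i j - int i | i j. i \<in> {1..p'} \<and> j \<in> {1..\<beta>' i}}" by simp
    show "y \<le> r" if "y \<in> {e' i j - int i | i j. i \<in> {1..p'} \<and> j \<in> {1..\<beta>' i}}" for y
      using that shifts(2)[OF _ _ res] by blast
    have "p' \<in> {1..p'}" using res by (simp add: is_min_graded_free_res_def)
    then show "r \<in> {e' i j - int i | i j. i \<in> {1..p'} \<and> j \<in> {1..\<beta>' i}}"
      using shifts(3)[OF _ _ res] by (blast intro: sym)
  qed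
  have "reg_quot (n + 1) (vanishing_ideal n m :: 'k mpoly set) = r"
    unfolding reg_quot_def
  proof (rule the_equality)
    show "\<exists>p \<beta> e (\<phi> :: nat \<Rightarrow> (nat \<Rightarrow> 'k mpoly) \<Rightarrow> nat \<Rightarrow> 'k mpoly).
        is_min_graded_free_res (n + 1) (vanishing_ideal n m) p \<beta> e \<phi> \<and>
        r = Max {e i j - int i | i j. i \<in> {1..p} \<and> j \<in> {1..\<beta> i}}"
      by (intro exI conjI, rule assms(11), rule Max_all[OF assms(11), symmetric])
  next
    fix r'
    assume "\<exists>p \<beta> e (\<phi> :: nat \<Rightarrow> (nat \<Rightarrow> 'k mpoly) \<Rightarrow> nat \<Rightarrow> 'k mpoly).
        is_min_graded_free_res (n + 1) (vanishing_ideal n m) p \<beta> e \<phi> \<and>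
        r' = Max {e i j - int i | i j. i \<in> {1..p} \<and> j \<in> {1..\<beta> i}}"
    then show "r' = r" using Max_all by blast
  qed
  also have "r = Max {e p j - int p | j. j \<in> {1..\<beta> p}}"
  proof (rule Max_eqI[symmetric])
    have "p \<in> {1..p}" using assms(11) by (simp add: is_min_graded_free_res_def)
    then show "y \<le> r" if "y \<in> {e p j - int p | j. j \<in> {1..\<beta> p}}" for y
      using that shifts(2)[OF _ _ assms(11)] by blast
    show "r \<in> {e p j - int p | j. j \<in> {1..\<beta> p}}"
      using shifts(3)[OF _ _ assms(11)] by (blast intro: sym)
  qed simp
  finally show ?thesis .
qed

end
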